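(* Let $x\in[0,1]$ be such that the derivative $F'(x)$ (finite or infinite) exists. Then either $F'(x)=0$ or $F'(x)=\infty$.
   Context: Continued fraction with minimal remainders: every real $x$ has a unique representation $$x=\left[a_0;\frac{\varepsilon_1}{a_1},\ldots,\frac{\varepsilon_l}{a_l},\ldots\right]=a_0+\cfrac{\varepsilon_1}{a_1+\cfrac{\varepsilon_2}{a_2+\ldots+\cfrac{\varepsilon_l}{a_l+\ldots}}},$$ finite if $x$ is rational and infinite if $x$ is irrational, where $a_0\in\mathbb{Z}$, $\varepsilon_j=\pm1$, $a_j\in\mathbb{Z}$, $a_j\geqslant 2$ for $j\geqslant1$, and $a_j+\varepsilon_{j+1}\geqslant2$ for $j\geqslant 1$ whenever $\varepsilon_{j+1}$ is present (equivalently, $a_j=2$ implies $\varepsilon_{j+1}=1$); for rational $x$, if the last partial quotient is $a_s=2$ with $s\geqslant1$, then $\varepsilon_s=1$. (It arises from the division $a=bq+r$, $-b/2<r\leqslant b/2$.) The numbers $a_i$ (including $a_0$) are the partial quotients. For rational $x$, $S(x)$ is the sum $a_0+a_1+\ldots+a_l$ of the partial quotients of this representation. Put $\mathcal{Z}_n=\{x\in\mathbb{Q}\cap[0,1]:S(x)\leqslant n+1\}$ (a finite set). The limit distribution function is $$F(x)=\lim_{n\to\infty}\frac{\#\{\xi\in\mathcal{Z}_n:\xi\leqslant x\}}{\#\mathcal{Z}_n},\qquad x\in[0,1].$$ Derivatives at the endpoints $0$ and $1$ are one-sided. *)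

theory Defs
  imports Complex_Main "HOL-Library.Extended_Real"
begin

text \<open>
  A finite continued fraction \<open>a\<^sub>0 + \<epsilon>\<^sub>1/(a\<^sub>1 + \<epsilon>\<^sub>2/(a\<^sub>2 + \<dots>))\<close> is encoded as the integer \<open>a\<^sub>0\<close>
  together with the list \<open>[(\<epsilon>\<^sub>1, a\<^sub>1), \<dots>, (\<epsilon>\<^sub>s, a\<^sub>s)]\<close>; list position \<open>j\<close> carries index \<open>j + 1\<close>.
\<close>

fun cf_tail :: "(int \<times> int) list \<Rightarrow> real" where
  "cf_tail [] = 0"
| "cf_tail ((e, a) # xs) = real_of_int e / (real_of_int a + cf_tail xs)"

definition cf_value :: "int \<times> (int \<times> int) list \<Rightarrow> real" where
  "cf_value c = real_of_int (fst c) + cf_tail (snd c)"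

definition minimal_remainders :: "(int \<times> int) list \<Rightarrow> bool" where
  "minimal_remainders xs \<longleftrightarrow>
     (\<forall>(e, a) \<in> set xs. (e = 1 \<or> e = - 1) \<and> a \<ge> 2) \<and>
     (\<forall>j. Suc j < length xs \<longrightarrow> snd (xs ! j) + fst (xs ! Suc j) \<ge> 2) \<and>
     (xs \<noteq> [] \<longrightarrow> snd (last xs) = 2 \<longrightarrow> fst (last xs) = 1)"

text \<open>
  Only meaningful for rational \<open>x\<close>, where exactly one finite expansion of this kind exists.
\<close>

definition minrem_cf :: "real \<Rightarrow> int \<times> (int \<times> int) list" where
  "minrem_cf x = (THE c. minimal_remainders (snd c) \<and> cf_value c = x)"

definition S :: "real \<Rightarrow> int" where
  "S x = fst (minrem_cf x) + sum_list (map snd (snd (minrem_cf x)))"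

definition Z :: "nat \<Rightarrow> real set" where
  "Z n = {x \<in> \<rat> \<inter> {0..1}. S x \<le> int n + 1}"

definition F :: "real \<Rightarrow> real" where
  "F x = lim (\<lambda>n. real (card {\<xi> \<in> Z n. \<xi> \<le> x}) / real (card (Z n)))"

text \<open>
  The derivative of \<open>f\<close> at \<open>x\<close> relative to \<open>A\<close> exists and equals \<open>L\<close>, where \<open>L\<close> may be infinite.
  For \<open>A = {0..1}\<close> it is one-sided at the endpoints and the usual derivative in between.
\<close>

definition has_ext_derivative :: "(real \<Rightarrow> real) \<Rightarrow> ereal \<Rightarrow> real \<Rightarrow> real set \<Rightarrow> bool" where
  "has_ext_derivative f L x A \<longleftrightarrow>
     ((\<lambda>y. ereal ((f y - f x) / (y - x))) \<longlongrightarrow> L) (at x within A)"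

lemma has_ext_derivative_finite_iff:
  "has_ext_derivative f (ereal D) x A \<longleftrightarrow> (f has_real_derivative D) (at x within A)"
  by (simp add: has_ext_derivative_def has_field_derivative_iff)

end

theory Submission
  imports Defs "HOL-Analysis.Analysis"
begin

text \<open>
  Let \<open>\<tau>\<close> be the positive root of \<open>u^3 + u^2 + u = 1\<close>. The rules \<open>S (1/(n + y)) = n + S y\<close> for \<open>n \<ge> 2\<close>
  and \<open>S (1 - y) = 1 + S y\<close> for \<open>y < 1/2\<close> yield a tribonacci recurrence, up to bounded errors, for the
  number of \<open>\<xi> \<le> 1/2\<close> with \<open>S \<xi> \<le> m\<close>, and make \<open>F\<close> self-similar: on each image of \<open>[0, 1]\<close> under a
  composition \<open>M\<close> of the branches \<open>t \<mapsto> 1/(n + t)\<close> and \<open>t \<mapsto> 1 - 1/(n + t)\<close>, the function \<open>F \<circ> M\<close> is an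
  affine function of \<open>F\<close>. These compositions are Moebius maps with bounded distortion. If \<open>x\<close> lies in
  arbitrarily deep images and \<open>F\<close> has a finite derivative \<open>D \<noteq> 0\<close> at \<open>x\<close>, then all chord slopes over
  the images of \<open>0, 1/3, 1/2, 1\<close> tend to \<open>D\<close>, so these points have the same cross ratio as their
  values under \<open>F\<close>; but the former is \<open>1/2\<close> and the latter \<open>\<tau>^2\<close>. The remaining \<open>x\<close> are rational, and
  there \<open>F\<close> has increments of order \<open>\<tau>^n\<close> at distance of order \<open>1/n\<close>, which forces \<open>F' x = 0\<close>.
\<close>

section \<open>Expansions with minimal remainders\<close>

lemma minimal_remainders_Nil [simp]: "minimal_remainders []"
  by (simp add: minimal_remainders_def)

text \<open>Replaces the conditions on positions and on the last entry by a recursion along the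
  list, which is the form suited to induction.\<close>

lemma minimal_remainders_Cons:
  "minimal_remainders ((e, a) # xs) \<longleftrightarrow>
     (e = 1 \<or> e = - 1) \<and> a \<ge> 2 \<and> (xs = [] \<longrightarrow> a = 2 \<longrightarrow> e = 1) \<and>
     (xs \<noteq> [] \<longrightarrow> a + fst (hd xs) \<ge> 2) \<and> minimal_remainders xs"
proof (cases xs)
  case Nil
  then show ?thesis by (auto simp: minimal_remainders_def)
next
  case (Cons p ys)
  have *: "(\<forall>j. P j) \<longleftrightarrow> P 0 \<and> (\<forall>j. P (Suc j))" for P
    using not0_implies_Suc by metis
  show ?thesis
    unfolding minimal_remainders_def Cons
    by (subst *) auto
qed

text \<open>The bounds and the sign claim depend on each other. If \<open>a = 2\<close> and the list
  continues, the next sign is +1, so by the sign claim the tail is positive and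
  \<open>a + t > 2\<close>; if \<open>a \<ge> 3\<close>, \<open>t > -1/2\<close> is enough. Only a
  final quotient 2 gives \<open>a + t = 2\<close>, and its sign +1 yields 1/2 but never
  -1/2.\<close>

lemma cf_tail_bounds:
  assumes "minimal_remainders xs"
  shows "- 1/2 < cf_tail xs" "cf_tail xs \<le> 1/2"
    and "xs \<noteq> [] \<Longrightarrow> real_of_int (fst (hd xs)) * cf_tail xs > 0"
  using assms
proof (induction xs)
  case (Cons p xs)
  obtain e a where p: "p = (e, a)" by (cases p)
  define t where "t = cf_tail xs"
  { assume prems: "minimal_remainders (p # xs)"
    have m: "e = 1 \<or> e = - 1" "a \<ge> 2" "xs = [] \<longrightarrow> a = 2 \<longrightarrow> e = 1"
        "xs \<noteq> [] \<longrightarrow> a + fst (hd xs) \<ge> 2" "minimal_remainders xs"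
      using prems unfolding p minimal_remainders_Cons by auto
    have t: "- 1/2 < t" "t \<le> 1/2" "xs \<noteq> [] \<Longrightarrow> real_of_int (fst (hd xs)) * t > 0"
      using Cons.IH m(5) by (auto simp: t_def)
    have at: "2 < a + t \<or> a + t = 2 \<and> e = 1"
    proof (cases "a = 2")
      case True
      show ?thesis
      proof (cases "xs = []")
        case True
        then show ?thesis using \<open>a = 2\<close> m by (simp add: t_def)
      next
        case False
        then obtain q ys where q: "xs = q # ys" by (cases xs) auto
        have "fst q = 1 \<or> fst q = -1"
          using m(5) q by (cases q) (auto simp: minimal_remainders_Cons)
        then have "fst q = 1" using m(4) q True by auto
        then show ?thesis using t(3) q True by auto
      qed
    next
      case False
      then have "real_of_int a \<ge> 3" using m(2) by simp
      then show ?thesis using t by linarith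
    qed
    have v: "cf_tail (p # xs) = e / (a + t)" by (simp add: p t_def)
    have "- 1/2 < e / (a + t) \<and> e / (a + t) \<le> 1/2 \<and> real_of_int e * (e / (a + t)) > 0"
      using at m(1) by (auto simp: field_simps)
    then have "- 1/2 < cf_tail (p # xs) \<and> cf_tail (p # xs) \<le> 1/2 \<and>
        real_of_int (fst (hd (p # xs))) * cf_tail (p # xs) > 0"
      unfolding v by (simp add: p)
  } note * = this
  { case 1 then show ?case using * by blast }
  { case 2 then show ?case using * by blast }
  { case 3 then show ?case using * by blast }
qed auto

lemma int_eq_if_shifts_eq:
  fixes a b :: int and s t :: real
  assumes "a + s = b + t" "- 1/2 < s" "s \<le> 1/2" "- 1/2 < t" "t \<le> 1/2"
  shows "a = b" "s = t"
proof -
  have "real_of_int a < b + 1" "real_of_int b < a + 1" using assms by linarith+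
  then show "a = b" by linarith
  then show "s = t" using assms(1) by simp
qed

lemma cf_tail_eq_0_iff:
  assumes "minimal_remainders xs"
  shows "cf_tail xs = 0 \<longleftrightarrow> xs = []"
  using cf_tail_bounds(3)[OF assms] by (cases "xs = []") auto

text \<open>The sign of the value determines the first sign; after inversion, the half-open interval
  of length 1 from \<open>cf_tail_bounds\<close> determines the first quotient and the remaining
  tail.\<close>

lemma cf_tail_inj:
  assumes "minimal_remainders xs" "minimal_remainders ys" "cf_tail xs = cf_tail ys"
  shows "xs = ys"
  using assms
proof (induction xs arbitrary: ys)
  case Nil
  then show ?case using cf_tail_eq_0_iff by force
next
  case (Cons p xs)
  obtain e a where p: "p = (e, a)" by (cases p)
  obtain q zs where ys: "ys = q # zs"
    using Cons.prems cf_tail_eq_0_iff by (metis list.exhaust list.simps(3))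
  obtain f b where q: "q = (f, b)" by (cases q)
  have m: "e = 1 \<or> e = - 1" "minimal_remainders xs" "f = 1 \<or> f = - 1" "minimal_remainders zs"
    using Cons.prems by (auto simp: p q ys minimal_remainders_Cons)
  have pos: "real_of_int e * cf_tail (p # xs) > 0" "real_of_int f * cf_tail (p # xs) > 0"
    using cf_tail_bounds(3)[OF Cons.prems(1)] cf_tail_bounds(3)[OF Cons.prems(2)]
    unfolding Cons.prems(3) by (simp_all add: p q ys)
  then have "e = f" using m by (auto simp: zero_less_mult_iff)
  moreover have "e / (a + cf_tail xs) = f / (b + cf_tail zs)"
    using Cons.prems(3) by (simp add: p q ys)
  moreover have "real_of_int e \<noteq> 0" using m by auto
  ultimately have "real_of_int a + cf_tail xs = b + cf_tail zs"
    using pos(1) by (auto simp: p divide_inverse)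
  then have "a = b" "cf_tail xs = cf_tail zs"
    using int_eq_if_shifts_eq[of a "cf_tail xs" b "cf_tail zs"] cf_tail_bounds m by blast+
  with Cons.IH m \<open>e = f\<close> show ?case by (simp add: p q ys)
qed

text \<open>Relational form of the expansion, so that expansions can be built without the
  description operator in \<open>minrem_cf\<close>; \<open>S_eqI\<close> makes the link.\<close>

definition expands :: "real \<Rightarrow> int \<Rightarrow> (int \<times> int) list \<Rightarrow> bool" where
  "expands x a xs \<longleftrightarrow> minimal_remainders xs \<and> x = a + cf_tail xs"

lemma S_eqI:
  assumes "expands x a xs"
  shows "S x = a + sum_list (map snd xs)"
proof -
  have "minrem_cf x = (a, xs)"
    unfolding minrem_cf_def
  proof (rule the_equality)
    show "minimal_remainders (snd (a, xs)) \<and> cf_value (a, xs) = x"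
      using assms by (simp add: expands_def cf_value_def)
  next
    fix c assume c: "minimal_remainders (snd c) \<and> cf_value c = x"
    then have "real_of_int (fst c) + cf_tail (snd c) = a + cf_tail xs"
      using assms by (simp add: expands_def cf_value_def)
    then have "fst c = a" "cf_tail (snd c) = cf_tail xs"
      using int_eq_if_shifts_eq[of "fst c" "cf_tail (snd c)" a "cf_tail xs"]
        cf_tail_bounds assms c unfolding expands_def by blast+
    then show "c = (a, xs)"
      using cf_tail_inj assms c by (auto simp: expands_def prod_eq_iff)
  qed
  then show ?thesis by (simp add: S_def)
qed

text \<open>A point of [0, 1] lies to the right of 0 or to the left of 1, which fixes the first
  sign. This supplies the admissibility check when a quotient is put in front.\<close>

lemma expands_unit_interval:
  assumes "expands y a xs" "0 \<le> y" "y \<le> 1"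
  shows "a = 0 \<or> a = 1"
    and "a = 0 \<Longrightarrow> xs \<noteq> [] \<Longrightarrow> fst (hd xs) = 1"
    and "a = 1 \<Longrightarrow> xs \<noteq> [] \<Longrightarrow> fst (hd xs) = - 1"
proof -
  have m: "minimal_remainders xs" "y = a + cf_tail xs" using assms by (auto simp: expands_def)
  note t = cf_tail_bounds[OF m(1)]
  have "real_of_int a > - 1" "real_of_int a < 2" using t m assms by linarith+
  then show "a = 0 \<or> a = 1" by linarith
  have e: "fst (hd xs) = 1 \<or> fst (hd xs) = - 1" if "xs \<noteq> []"
    using m(1) that by (cases xs; cases "hd xs") (auto simp: minimal_remainders_Cons)
  show "fst (hd xs) = 1" if "a = 0" "xs \<noteq> []"
    using e t(3) m(2) assms that by fastforce
  show "fst (hd xs) = - 1" if "a = 1" "xs \<noteq> []"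
    using e t(3) m(2) assms that by fastforce
qed

text \<open>The integer part \<open>a\<close> of \<open>y\<close> is absorbed into the new quotient.
  If \<open>a = 1\<close>, a following sign is -1, but then \<open>n + a \<ge> 3\<close>; if
  \<open>a = 0\<close>, it is +1 and \<open>n \<ge> 2\<close> suffices.\<close>

lemma expands_inverse:
  assumes "expands y a xs" "0 \<le> y" "y \<le> 1" "n \<ge> 2"
  shows "expands (1 / (of_int n + y)) 0 ((1, n + a) # xs)"
proof -
  have "minimal_remainders ((1, n + a) # xs)"
    unfolding minimal_remainders_Cons
    using expands_unit_interval[OF assms(1-3)] assms(1,4) by (auto simp: expands_def)
  then show ?thesis using assms(1) by (auto simp: expands_def add.assoc)
qed

text \<open>Passing from \<open>0 + 1/(b + ...)\<close> to \<open>1 - 1/(b + ...)\<close> flips only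
  the first sign. The point 1/2 is excluded because the flip would end its expansion with quotient 2
  and sign -1.\<close>

lemma expands_reflect:
  assumes "expands y a xs" "0 \<le> y" "y < 1/2"
  shows "\<exists>ys. expands (1 - y) 1 ys \<and> a = 0 \<and> map snd ys = map snd xs"
proof -
  have m: "minimal_remainders xs" "y = a + cf_tail xs" using assms by (auto simp: expands_def)
  note t = cf_tail_bounds[OF m(1)]
  have a: "a = 0"
  proof -
    have "real_of_int a < 1" using t m assms by linarith
    moreover have "a = 0 \<or> a = 1" using expands_unit_interval(1)[OF assms(1)] assms by simp
    ultimately show ?thesis by auto
  qed
  show ?thesis
  proof (cases xs)
    case Nil
    have "expands (1 - y) 1 []" using m a Nil by (simp add: expands_def)
    then show ?thesis using a Nil by auto
  next
    case (Cons p zs)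
    obtain e b where p: "p = (e, b)" by (cases p)
    have e: "e = 1" using expands_unit_interval(2)[OF assms(1)] assms a Cons p by simp
    have "b = 2 \<Longrightarrow> zs \<noteq> []" using m a Cons p e assms by auto
    then have "expands (1 - y) 1 ((- 1, b) # zs)"
      using m a Cons p e by (auto simp: expands_def minimal_remainders_Cons)
    then show ?thesis using a Cons p by (intro exI[of _ "(- 1, b) # zs"]) auto
  qed
qed

text \<open>Euclid's algorithm, as induction on the denominator: if \<open>q = n * r + s\<close>,
  then \<open>r / q = 1 / (n + s / r)\<close>, and \<open>s / r\<close> has the smaller denominator
  \<open>r\<close>. Fractions above 1/2 are reflected first.\<close>

lemma expands_fraction:
  fixes p q :: nat
  assumes "p \<le> q" "0 < q"
  shows "\<exists>a xs. expands (p / q) a xs"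
  using assms
proof (induction q arbitrary: p rule: less_induct)
  case (less q)
  have half: "\<exists>a xs. expands (r / q) a xs" if "2 * r \<le> q" for r :: nat
  proof (cases "r = 0")
    case True
    have "expands 0 0 []" by (simp add: expands_def)
    then show ?thesis using True by auto
  next
    case False
    define n where "n = q div r"
    define s where "s = q mod r"
    have q: "q = n * r + s" "s < r" using False by (auto simp: n_def s_def)
    have n: "n \<ge> 2" using that False unfolding n_def
      by (metis div_le_mono nonzero_mult_div_cancel_right)
    have "r < q" using that False by simp
    then obtain a xs where e: "expands (s / r) a xs" using less.IH[of r s] q False by auto
    have "expands (1 / (of_int (int n) + s / r)) 0 ((1, int n + a) # xs)"
      by (rule expands_inverse[OF e]) (use q n in auto)
    moreover have "1 / (of_int (int n) + s / r) = real r / q"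
      using False by (simp add: q(1) field_simps)
    ultimately show ?thesis by auto
  qed
  show ?case
  proof (cases "2 * p \<le> q")
    case True
    then show ?thesis using half by blast
  next
    case False
    obtain a xs where "expands (real (q - p) / q) a xs" using half[of "q - p"] False by force
    then obtain ys where "expands (1 - real (q - p) / q) 1 ys"
      using expands_reflect[of "real (q - p) / q" a xs] False less.prems
      by (force simp: field_simps of_nat_diff)
    moreover have "1 - real (q - p) / q = p / q"
      using less.prems by (simp add: field_simps of_nat_diff)
    ultimately show ?thesis by auto
  qed
qed

lemma expands_exists:
  assumes "y \<in> \<rat>" "0 \<le> y" "y \<le> 1"
  obtains a xs where "expands y a xs"
proof -
  obtain p q :: nat where "q \<noteq> 0" "\<bar>y\<bar> = p / q" using Rats_abs_nat_div_natE[OF assms(1)] by metis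
  then have y: "y = p / q" "0 < q" using assms by auto
  then have "real p \<le> q" using assms(3) by (simp add: divide_le_eq)
  then have "p \<le> q" by simp
  with y expands_fraction[of p q] that show ?thesis by metis
qed

section \<open>Functional equations of the digit sum\<close>

lemma S_0 [simp]: "S 0 = 0"
  using S_eqI[of 0 0 "[]"] by (simp add: expands_def)

lemma S_nonneg:
  assumes "y \<in> \<rat>" "0 \<le> y" "y \<le> 1"
  shows "S y \<ge> 0"
proof -
  obtain a xs where e: "expands y a xs" using expands_exists assms by blast
  have "0 \<le> sum_list (map snd xs)"
    using e by (intro sum_list_nonneg) (force simp: expands_def minimal_remainders_def)
  then show ?thesis using S_eqI[OF e] expands_unit_interval(1)[OF e] assms by auto
qed

lemma S_inverse_add:
  assumes "y \<in> \<rat>" "0 \<le> y" "y \<le> 1" "n \<ge> 2"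
  shows "S (1 / (of_int n + y)) = n + S y"
proof -
  obtain a xs where e: "expands y a xs" using expands_exists assms by blast
  show ?thesis using S_eqI[OF e] S_eqI[OF expands_inverse[OF e]] assms by simp
qed

lemma S_reflect:
  assumes "y \<in> \<rat>" "0 \<le> y" "y < 1/2"
  shows "S (1 - y) = 1 + S y"
proof -
  obtain a xs where e: "expands y a xs" using expands_exists[of y] assms by auto
  then obtain ys where "expands (1 - y) 1 ys" "a = 0" "map snd ys = map snd xs"
    using expands_reflect assms by blast
  then show ?thesis using S_eqI[OF e] S_eqI[of "1 - y" 1 ys] by simp
qed

lemma inverse_decomp:
  fixes y :: real
  assumes "0 < y" "y \<le> 1/2"
  obtains n t where "n \<ge> 2" "0 \<le> t" "t < 1" "y = 1 / (of_int n + t)" "y \<in> \<rat> \<Longrightarrow> t \<in> \<rat>"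
proof
  have "1 / y \<ge> 2" using assms by (simp add: field_simps)
  then show "\<lfloor>1 / y\<rfloor> \<ge> 2" by linarith
  show "0 \<le> frac (1 / y)" "frac (1 / y) < 1" by (simp_all add: frac_lt_1)
  show "y = 1 / (of_int \<lfloor>1 / y\<rfloor> + frac (1 / y))" by (simp add: frac_def)
  show "frac (1 / y) \<in> \<rat>" if "y \<in> \<rat>" using that by (simp add: frac_def)
qed

text \<open>On \<open>y = 1 / (n + t)\<close> the map adds 1 to \<open>n\<close>. Its fixed point 0
  has to be left out.\<close>

lemma S_parabolic:
  assumes "y \<in> \<rat>" "0 < y" "y \<le> 1/2"
  shows "S (y / (1 + y)) = 1 + S y"
proof -
  obtain n t where t: "n \<ge> 2" "0 \<le> t" "t < 1" "y = 1 / (of_int n + t)" "t \<in> \<rat>"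
    using inverse_decomp assms by metis
  have "real_of_int n + t > 0" using t by linarith
  then have "y / (1 + y) = 1 / (of_int (n + 1) + t)"
    unfolding t(4) by (simp add: divide_simps)
  then show ?thesis
    using t S_inverse_add[of t n] S_inverse_add[of t "n + 1"] by simp
qed

section \<open>Contractive recursions and tribonacci growth\<close>

lemma geometric_shrink:
  fixes B \<epsilon> :: real
  assumes "P B" "B > 0" "\<And>e. e > 0 \<Longrightarrow> P e \<Longrightarrow> P (9/10 * e)" "\<epsilon> > 0"
  shows "\<exists>e. 0 < e \<and> e < \<epsilon> \<and> P e"
proof -
  have P: "P ((9/10)^k * B)" for k
    using assms(1,2,3) by (induction k) (auto simp: mult.assoc)
  have "(\<lambda>k. (9/10)^k * B) \<longlonglongrightarrow> 0 * B"
    by (intro tendsto_intros LIMSEQ_power_zero) auto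
  then have "eventually (\<lambda>k. (9/10)^k * B < \<epsilon>) sequentially"
    using \<open>\<epsilon> > 0\<close> by (auto dest!: order_tendstoD(2))
  then obtain k where "(9/10)^k * B < \<epsilon>" by (auto simp: eventually_sequentially)
  then show ?thesis using P[of k] \<open>B > 0\<close> by (intro exI[of _ "(9/10)^k * B"]) auto
qed

text \<open>
  The oscillation \<open>limsup - liminf\<close> of the sequences \<open>a _ x\<close>, maximised over \<open>x\<close>, is contracted
  by the recursion and therefore vanishes.
\<close>

lemma convergent_contractive_recursion:
  fixes a :: "nat \<Rightarrow> 'a \<Rightarrow> real"
  assumes bdd: "\<And>m x. x \<in> X \<Longrightarrow> \<bar>a m x\<bar> \<le> B"
    and step: "\<And>x. x \<in> X \<Longrightarrow> \<exists>i j r s s' y z. y \<in> X \<and> z \<in> X \<and> \<bar>s\<bar> + \<bar>s'\<bar> \<le> 8/10 \<and> convergent r \<and>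
        (\<forall>m. a (m + j) x = r m + s * a m y + s' * a (m + i) z)"
    and "x \<in> X"
  shows "convergent (\<lambda>m. a m x)"
proof -
  \<comment> \<open>One bound \<open>e\<close> on the eventual oscillation serves all
    \<open>x\<close>, while the threshold \<open>N\<close> may depend on \<open>x\<close>.\<close>
  define P where "P e \<longleftrightarrow> (\<forall>x\<in>X. \<exists>N. \<forall>m\<ge>N. \<forall>k\<ge>N. \<bar>a m x - a k x\<bar> \<le> e)" for e
  have P0: "P (2 * \<bar>B\<bar> + 1)"
    unfolding P_def
  proof (intro ballI exI allI impI)
    fix x m k assume "x \<in> X"
    then show "\<bar>a m x - a k x\<bar> \<le> 2 * \<bar>B\<bar> + 1" using bdd[of x m] bdd[of x k] by linarith
  qed
  \<comment> \<open>The recursion contributes at most \<open>8/10 * e\<close>, and the tail of the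
    convergent \<open>r\<close> at most \<open>e / 10\<close>.\<close>
  have P_step: "P (9/10 * e)" if "e > 0" "P e" for e
    unfolding P_def
  proof
    fix x assume "x \<in> X"
    from step[OF this] obtain i j r s s' y z where
      yz: "y \<in> X" "z \<in> X" and s: "\<bar>s\<bar> + \<bar>s'\<bar> \<le> 8/10" and "convergent r"
      and rec: "\<And>m. a (m + j) x = r m + s * a m y + s' * a (m + i) z"
      by blast
    then have "Cauchy r" by (simp add: Cauchy_convergent_iff)
    then obtain N1 where N1: "\<And>m k. m \<ge> N1 \<Longrightarrow> k \<ge> N1 \<Longrightarrow> \<bar>r m - r k\<bar> < e / 10"
      using \<open>e > 0\<close> unfolding Cauchy_def dist_real_def by (metis divide_pos_pos zero_less_numeral)
    obtain N2 where N2: "\<And>m k. m \<ge> N2 \<Longrightarrow> k \<ge> N2 \<Longrightarrow> \<bar>a m y - a k y\<bar> \<le> e"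
      using \<open>P e\<close> yz(1) unfolding P_def by blast
    obtain N3 where N3: "\<And>m k. m \<ge> N3 \<Longrightarrow> k \<ge> N3 \<Longrightarrow> \<bar>a m z - a k z\<bar> \<le> e"
      using \<open>P e\<close> yz(2) unfolding P_def by blast
    define N where "N = max N1 (max N2 N3) + j"
    have "\<bar>a m x - a k x\<bar> \<le> 9/10 * e" if mk: "m \<ge> N" "k \<ge> N" for m k
    proof -
      obtain m' k' where m': "m = m' + j" "k = k' + j"
        using mk unfolding N_def by (metis add.commute le_add2 le_trans nat_le_iff_add)
      then have ge: "m' \<ge> N1" "k' \<ge> N1" "m' \<ge> N2" "k' \<ge> N2" "m' + i \<ge> N3" "k' + i \<ge> N3"
        using mk unfolding N_def by auto
      have "a m x - a k x = (r m' - r k') + s * (a m' y - a k' y) + s' * (a (m' + i) z - a (k' + i) z)"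
        unfolding m' rec by (simp add: algebra_simps)
      moreover have "\<bar>s * (a m' y - a k' y)\<bar> \<le> \<bar>s\<bar> * e"
        unfolding abs_mult using N2[OF ge(3,4)] by (intro mult_left_mono) auto
      moreover have "\<bar>s' * (a (m' + i) z - a (k' + i) z)\<bar> \<le> \<bar>s'\<bar> * e"
        unfolding abs_mult using N3[OF ge(5,6)] by (intro mult_left_mono) auto
      moreover have "\<bar>s\<bar> * e + \<bar>s'\<bar> * e \<le> 8/10 * e"
        using mult_right_mono[OF s, of e] \<open>e > 0\<close> by (simp add: distrib_right)
      ultimately show ?thesis using N1[OF ge(1,2)] by linarith
    qed
    then show "\<exists>N. \<forall>m\<ge>N. \<forall>k\<ge>N. \<bar>a m x - a k x\<bar> \<le> 9/10 * e" by blast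
  qed
  have "Cauchy (\<lambda>m. a m x)"
    unfolding Cauchy_def dist_real_def
  proof (intro allI impI)
    fix \<epsilon> :: real assume "\<epsilon> > 0"
    then obtain e where "e < \<epsilon>" "P e"
      using geometric_shrink[of P "2 * \<bar>B\<bar> + 1"] P0 P_step by force
    then show "\<exists>M. \<forall>m\<ge>M. \<forall>n\<ge>M. \<bar>a m x - a n x\<bar> < \<epsilon>"
      using \<open>x \<in> X\<close> unfolding P_def by (meson order_le_less_trans)
  qed
  then show ?thesis by (simp add: Cauchy_convergent_iff)
qed

text \<open>The reciprocal of the tribonacci constant.\<close>

definition \<tau> :: real where
  "\<tau> = (SOME u. 0 < u \<and> u^3 + u^2 + u = 1)"

lemma \<tau>_root: "0 < \<tau>" "\<tau>^3 + \<tau>^2 + \<tau> = 1"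
proof -
  have "\<exists>u\<ge>0. u \<le> 1 \<and> u^3 + u^2 + u = (1::real)"
    by (rule IVT') (auto intro!: continuous_intros)
  then obtain u :: real where u: "u \<ge> 0" "u^3 + u^2 + u = 1" by blast
  then have "u \<noteq> 0" by auto
  with u have "0 < u \<and> u^3 + u^2 + u = 1" by simp
  then have "0 < \<tau> \<and> \<tau>^3 + \<tau>^2 + \<tau> = 1" unfolding \<tau>_def by (rule someI)
  then show "0 < \<tau>" "\<tau>^3 + \<tau>^2 + \<tau> = 1" by auto
qed

lemma \<tau>_less: "\<tau> < 6/10"
proof (rule ccontr)
  assume "\<not> \<tau> < 6/10"
  then have "\<tau>^3 \<ge> (6/10)^3" "\<tau>^2 \<ge> (6/10)^2" by (auto intro!: power_mono)
  then show False using \<tau>_root \<open>\<not> \<tau> < 6/10\<close> by (simp add: power_divide)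
qed

text \<open>Keeps the two cross ratios of the final argument apart.\<close>

lemma \<tau>_square_neq_half: "\<tau>^2 \<noteq> 1/2"
proof
  assume *: "\<tau>^2 = 1/2"
  have "\<tau>^3 = \<tau> * \<tau>^2" by (simp add: power3_eq_cube power2_eq_square)
  then have "\<tau> = 1/3" using * \<tau>_root(2) by simp
  with * have "(1/3 :: real)^2 = 1/2" by (simp only:)
  then show False by (simp add: power_divide)
qed

lemma \<tau>_powers_small: "\<tau>^2 + 2 * \<tau>^3 \<le> 8/10"
proof -
  have "\<tau>^3 \<le> (6/10)^3" "\<tau>^2 \<le> (6/10)^2"
    using \<tau>_root(1) \<tau>_less by (auto intro!: power_mono)
  then show ?thesis by (simp add: power_divide)
qed

text \<open>After scaling by \<open>\<tau>^m\<close> the bounded errors of the recurrence become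
  summable. Hence the nearly invariant combination \<open>W\<close> of three consecutive terms
  converges, and \<open>b\<close> is recovered from it.\<close>

lemma tribonacci_growth:
  fixes h :: "nat \<Rightarrow> real"
  assumes nonneg: "\<And>m. h m \<ge> 0"
    and lower: "\<And>m. h (m + 3) \<ge> h (m + 2) + h (m + 1) + h m"
    and upper: "\<And>m. h (m + 3) \<le> h (m + 2) + h (m + 1) + h m + c"
    and pos: "h k > 0"
  shows "\<exists>l>0. (\<lambda>m. h m * \<tau>^m) \<longlonglongrightarrow> l"
proof -
  define b where "b m = h m * \<tau>^m" for m
  \<comment> \<open>\<open>W\<close> is constant on exact solutions of the recurrence: its coefficients form the left
      eigenvector of the tribonacci matrix for the eigenvalue \<open>1/\<tau>\<close>.\<close>
  define W where "W m = b (m + 2) + (\<tau>^2 + \<tau>^3) * b (m + 1) + \<tau>^3 * b m" for m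
  have t: "0 < \<tau>" "\<tau> < 1" using \<tau>_root \<tau>_less by auto
  have b_nonneg: "b m \<ge> 0" for m using nonneg t by (simp add: b_def)
  have W_Suc: "W (Suc m) - W m = (h (m + 3) - h (m + 2) - h (m + 1) - h m) * \<tau>^(m+3)" for m
  proof -
    have "W (Suc m) - W m - (h (m + 3) - h (m + 2) - h (m + 1) - h m) * \<tau>^(m+3) =
        \<tau>^(m + 2) * h (m + 2) * (\<tau>^3 + \<tau>^2 + \<tau> - 1)"
      by (simp add: W_def b_def power_add power2_eq_square power3_eq_cube algebra_simps
            numeral_3_eq_3)
    then show ?thesis using \<tau>_root(2) by simp
  qed
  have W_inc: "0 \<le> W (Suc m) - W m" "W (Suc m) - W m \<le> \<bar>c\<bar> * \<tau>^m" for m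
  proof -
    show "0 \<le> W (Suc m) - W m" using lower[of m] t unfolding W_Suc by simp
    have "(h (m + 3) - h (m + 2) - h (m + 1) - h m) * \<tau>^(m+3) \<le> \<bar>c\<bar> * \<tau>^m"
      using upper[of m] lower[of m] t by (intro mult_mono power_decreasing) auto
    then show "W (Suc m) - W m \<le> \<bar>c\<bar> * \<tau>^m" unfolding W_Suc .
  qed
  have "summable (\<lambda>m. W (Suc m) - W m)"
  proof (rule summable_comparison_test')
    show "summable (\<lambda>m. \<bar>c\<bar> * \<tau>^m)" using t by (intro summable_mult summable_geometric) auto
    show "norm (W (Suc m) - W m) \<le> \<bar>c\<bar> * \<tau>^m" if "m \<ge> 0" for m using W_inc[of m] by simp
  qed
  then have "convergent (\<lambda>n. \<Sum>m<n. W (Suc m) - W m)" by (simp add: summable_iff_convergent)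
  then have "convergent (\<lambda>n. W n - W 0)" by (simp add: sum_lessThan_telescope)
  then have convW: "convergent W" using convergent_diff_const_right_iff by blast
  have b_le_W: "b (m + 2) \<le> W m" for m
    using b_nonneg t by (simp add: W_def)
  have "Bseq b"
  proof -
    obtain K where K: "\<And>m. \<bar>W m\<bar> \<le> K"
      using convergent_imp_Bseq[OF convW] unfolding Bseq_def by auto
    have "Bseq (\<lambda>m. b (m + 2))"
    proof (rule BseqI')
      show "norm (b (m + 2)) \<le> K" for m using b_le_W[of m] b_nonneg[of "m + 2"] K[of m] by simp
    qed
    then show ?thesis by (rule Bseq_offset)
  qed
  then obtain K where K: "\<And>m. \<bar>b m\<bar> \<le> K" unfolding Bseq_def by auto
  \<comment> \<open>The definition of \<open>W\<close>, solved for \<open>b (m + 2)\<close>, is a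
    recursion driven by the convergent \<open>W\<close>; the absolute values of the other
    coefficients add up to \<open>\<tau>^2 + 2 * \<tau>^3 < 1\<close>.\<close>
  have "convergent (\<lambda>m. b m)"
  proof (rule convergent_contractive_recursion[of "{()}" "\<lambda>m _. b m" K])
    show "\<bar>b m\<bar> \<le> K" for m by (rule K)
    show "\<exists>i j r s s' y z. y \<in> {()} \<and> z \<in> {()} \<and> \<bar>s\<bar> + \<bar>s'\<bar> \<le> 8/10 \<and> convergent r \<and>
        (\<forall>m. b (m + j) = r m + s * b m + s' * b (m + i))" for x
    proof -
      have "\<bar>- (\<tau>^3)\<bar> + \<bar>- (\<tau>^2 + \<tau>^3)\<bar> \<le> 8/10"
        using \<tau>_powers_small zero_less_power[OF t(1), of 2] zero_less_power[OF t(1), of 3]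
        by linarith
      moreover have "\<forall>m. b (m + 2) = W m + - (\<tau>^3) * b m + - (\<tau>^2 + \<tau>^3) * b (m + 1)"
        by (simp add: W_def algebra_simps)
      ultimately show ?thesis using convW by blast
    qed
  qed auto
  then obtain l where l: "b \<longlonglongrightarrow> l" unfolding convergent_def by auto
  \<comment> \<open>\<open>W\<close> increases to a positive multiple of \<open>l\<close>, so
    \<open>W k > 0\<close> forces \<open>l > 0\<close>.\<close>
  have "W \<longlonglongrightarrow> l + (\<tau>^2 + \<tau>^3) * l + \<tau>^3 * l"
    unfolding W_def using l by (intro tendsto_intros LIMSEQ_ignore_initial_segment)
  moreover have "incseq W" by (rule incseq_SucI) (use W_inc in auto)
  ultimately have "W k \<le> l * (1 + \<tau>^2 + 2 * \<tau>^3)"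
    using incseq_le by (fastforce simp: algebra_simps)
  moreover have "W k > 0"
    using b_nonneg[of "k + 2"] b_nonneg[of "k + 1"] pos t
    by (auto simp: W_def b_def intro!: add_nonneg_pos)
  ultimately have "l * (1 + \<tau>^2 + 2 * \<tau>^3) > 0" by linarith
  moreover have "1 + \<tau>^2 + 2 * \<tau>^3 > 0" using t by (intro add_pos_pos) auto
  ultimately have "l > 0" by (simp add: zero_less_mult_iff)
  then show ?thesis using l by (auto simp: b_def[abs_def])
qed

section \<open>Counting rationals and the limit distribution\<close>

text \<open>The bound is \<open>m\<close> itself, so \<open>Z n\<close> becomes
  \<open>Zs (n + 1) 1\<close>.\<close>

definition Zs :: "nat \<Rightarrow> real \<Rightarrow> real set" where
  "Zs m x = {\<xi> \<in> \<rat>. 0 \<le> \<xi> \<and> \<xi> \<le> x \<and> S \<xi> \<le> int m}"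

definition cnt :: "nat \<Rightarrow> real \<Rightarrow> real" where
  "cnt m x = real (card (Zs m x))"

text \<open>A point of (0, 1/2] is \<open>1 / (n + t)\<close> with \<open>n \<ge> 2\<close>, and
  \<open>t\<close> has digit sum at most \<open>m - n\<close>, so the induction hypothesis covers
  it. Points in (1/2, 1) are reflections of such points.\<close>

lemma finite_Zs_1: "finite (Zs m 1)"
proof (induction m rule: less_induct)
  case (less m)
  define B where "B = (\<Union>n\<in>{2..m}. (\<lambda>t. 1 / (real n + t)) ` Zs (m - n) 1)"
  have fin: "finite B"
    unfolding B_def using less.IH by (intro finite_UN_I finite_imageI) auto
  have low: "\<xi> \<in> B" if \<xi>: "\<xi> \<in> \<rat>" "0 < \<xi>" "\<xi> \<le> 1/2" "S \<xi> \<le> int m" for \<xi>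
  proof -
    obtain n t where t: "n \<ge> 2" "0 \<le> t" "t < 1" "\<xi> = 1 / (of_int n + t)" "t \<in> \<rat>"
      using inverse_decomp \<xi> by metis
    then have "S \<xi> = n + S t" "S t \<ge> 0" using S_inverse_add[of t n] S_nonneg[of t] by auto
    then have "nat n \<in> {2..m}" "t \<in> Zs (m - nat n) 1" "\<xi> = 1 / (real (nat n) + t)"
      using t \<xi> by (auto simp: Zs_def)
    then show ?thesis unfolding B_def by blast
  qed
  have "Zs m 1 \<subseteq> {0, 1} \<union> B \<union> (\<lambda>t. 1 - t) ` B"
  proof
    fix \<xi> assume "\<xi> \<in> Zs m 1"
    then have \<xi>: "\<xi> \<in> \<rat>" "0 \<le> \<xi>" "\<xi> \<le> 1" "S \<xi> \<le> int m" by (auto simp: Zs_def)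
    consider "\<xi> = 0" | "0 < \<xi>" "\<xi> \<le> 1/2" | "1/2 < \<xi>" "\<xi> < 1" | "\<xi> = 1" using \<xi> by linarith
    then show "\<xi> \<in> {0, 1} \<union> B \<union> (\<lambda>t. 1 - t) ` B"
    proof cases
      case 3
      then have "S \<xi> = 1 + S (1 - \<xi>)" using S_reflect[of "1 - \<xi>"] \<xi> by simp
      then have "1 - \<xi> \<in> B" using \<xi> 3 by (intro low) auto
      then have "1 - (1 - \<xi>) \<in> (\<lambda>t. 1 - t) ` B" by (rule imageI)
      then show ?thesis by simp
    qed (use low \<xi> in auto)
  qed
  then show ?case by (rule finite_subset) (use fin in auto)
qed

lemma finite_Zs:
  assumes "x \<le> 1"
  shows "finite (Zs m x)"
  by (rule finite_subset[OF _ finite_Zs_1[of m]]) (use assms in \<open>auto simp: Zs_def\<close>)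

lemma cnt_mono:
  assumes "x \<le> y" "y \<le> 1"
  shows "cnt m x \<le> cnt m y"
  unfolding cnt_def using finite_Zs[OF assms(2)] assms
  by (auto intro!: card_mono simp: Zs_def)

lemma cnt_0: "cnt m 0 = 1"
proof -
  have "Zs m 0 = {0}" by (auto simp: Zs_def)
  then show ?thesis by (simp add: cnt_def)
qed

lemma cnt_ge_1:
  assumes "0 \<le> x" "x \<le> 1"
  shows "cnt m x \<ge> 1"
  using cnt_mono[OF assms, of m] cnt_0[of m] by simp

text \<open>
  The half-open range on the left is needed because \<open>S_reflect\<close> fails at \<open>1/2\<close>; it costs at most
  one point in the count.
\<close>

lemma cnt_decreasing_branch:
  assumes y: "0 \<le> y" "y \<le> 1" and x: "0 \<le> x" "x \<le> w" "w \<le> 1"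
    and inj: "inj_on \<phi> {0..<y}"
    and S: "\<And>t. t \<in> \<rat> \<Longrightarrow> 0 \<le> t \<Longrightarrow> t < y \<Longrightarrow> S (\<phi> t) = int j + S t"
    and range: "\<And>t. 0 \<le> t \<Longrightarrow> t < y \<Longrightarrow> t \<in> \<rat> \<Longrightarrow> \<phi> t \<in> \<rat> \<and> x < \<phi> t \<and> \<phi> t \<le> w"
    and onto: "\<And>\<xi>. \<xi> \<in> \<rat> \<Longrightarrow> x < \<xi> \<Longrightarrow> \<xi> \<le> w \<Longrightarrow> \<exists>t\<in>\<rat>. 0 \<le> t \<and> t < y \<and> \<xi> = \<phi> t"
  shows "\<bar>cnt (m + j) w - cnt (m + j) x - cnt m y\<bar> \<le> 1"
proof -
  let ?H = "{t \<in> Zs m y. t < y}"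
  have "Zs (m + j) w - Zs (m + j) x = \<phi> ` ?H"
  proof (intro set_eqI iffI)
    fix \<xi> assume "\<xi> \<in> Zs (m + j) w - Zs (m + j) x"
    then have \<xi>: "\<xi> \<in> \<rat>" "0 \<le> \<xi>" "\<xi> \<le> w" "S \<xi> \<le> int (m + j)" "x < \<xi>" by (auto simp: Zs_def)
    then obtain t where t: "t \<in> \<rat>" "0 \<le> t" "t < y" "\<xi> = \<phi> t" using onto by blast
    then have "t \<in> ?H" using S[of t] \<xi> by (auto simp: Zs_def)
    then show "\<xi> \<in> \<phi> ` ?H" using t by blast
  next
    fix \<xi> assume "\<xi> \<in> \<phi> ` ?H"
    then obtain t where t: "t \<in> \<rat>" "0 \<le> t" "t < y" "S t \<le> int m" "\<xi> = \<phi> t" by (auto simp: Zs_def)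
    then show "\<xi> \<in> Zs (m + j) w - Zs (m + j) x"
      using range[of t] S[of t] x(1) by (auto simp: Zs_def)
  qed
  moreover have "inj_on \<phi> ?H" using inj by (rule inj_on_subset) (auto simp: Zs_def)
  ultimately have "card (Zs (m + j) w - Zs (m + j) x) = card ?H" by (simp add: card_image)
  moreover have "Zs (m + j) x \<subseteq> Zs (m + j) w" using x by (auto simp: Zs_def)
  ultimately have 1: "cnt (m + j) w - cnt (m + j) x = card ?H"
    using card_Diff_subset[OF finite_Zs, of x "m + j" "Zs (m + j) w"]
      card_mono[OF finite_Zs, of w "Zs (m + j) x" "m + j"] x
    by (simp add: cnt_def of_nat_diff)
  have fin: "finite (Zs m y)" by (rule finite_Zs[OF y(2)])
  have "card ?H \<le> card (Zs m y)" by (rule card_mono[OF fin]) blast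
  moreover have "card (Zs m y) \<le> card ?H + 1"
  proof -
    have finH: "finite ?H" by (rule finite_subset[OF _ fin]) blast
    have "Zs m y \<subseteq> insert y ?H" by (auto simp: Zs_def)
    then have "card (Zs m y) \<le> card (insert y ?H)" using finH by (intro card_mono) simp
    also have "\<dots> \<le> card ?H + 1" using finH by (simp add: card_insert_if)
    finally show ?thesis .
  qed
  ultimately show ?thesis unfolding 1 by (simp add: cnt_def)
qed

lemma cnt_reflect:
  assumes "0 \<le> y" "y \<le> 1/2"
  shows "\<bar>cnt (m + 1) 1 - cnt (m + 1) (1 - y) - cnt m y\<bar> \<le> 1"
proof (rule cnt_decreasing_branch[where \<phi> = "\<lambda>t. 1 - t"])
  show "\<exists>t\<in>\<rat>. 0 \<le> t \<and> t < y \<and> \<xi> = 1 - t" if "\<xi> \<in> \<rat>" "1 - y < \<xi>" "\<xi> \<le> 1" for \<xi>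
    using that by (intro bexI[of _ "1 - \<xi>"]) auto
  show "S (1 - t) = int 1 + S t" if "t \<in> \<rat>" "0 \<le> t" "t < y" for t
    using S_reflect[of t] assms that by simp
qed (use assms in \<open>auto simp: inj_on_def\<close>)

lemma cnt_inverse:
  assumes "0 \<le> y" "y \<le> 1"
  shows "\<bar>cnt (m + 2) (1/2) - cnt (m + 2) (1 / (2 + y)) - cnt m y\<bar> \<le> 1"
proof (rule cnt_decreasing_branch[where \<phi> = "\<lambda>t. 1 / (2 + t)"])
  show "\<exists>t\<in>\<rat>. 0 \<le> t \<and> t < y \<and> \<xi> = 1 / (2 + t)" if "\<xi> \<in> \<rat>" "1 / (2 + y) < \<xi>" "\<xi> \<le> 1/2" for \<xi>
  proof (intro bexI conjI)
    have pos: "0 < 1 / (2 + y)" using assms by simp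
    with that have "0 < \<xi>" by linarith
    then show "0 \<le> 1 / \<xi> - 2" "1 / \<xi> - 2 < y" "\<xi> = 1 / (2 + (1 / \<xi> - 2))"
      using that assms by (auto simp: field_simps)
    show "1 / \<xi> - 2 \<in> \<rat>" using that by simp
  qed
  show "S (1 / (2 + t)) = int 2 + S t" if "t \<in> \<rat>" "0 \<le> t" "t < y" for t
    using S_inverse_add[of t 2] assms that by simp
  show "inj_on (\<lambda>t. 1 / (2 + t)) {0..<y}" by (auto simp: inj_on_def)
  show "1 / (2 + t) \<in> \<rat> \<and> 1 / (2 + y) < 1 / (2 + t) \<and> 1 / (2 + t) \<le> 1/2"
    if "0 \<le> t" "t < y" "t \<in> \<rat>" for t
    using that by (auto simp: field_simps)
qed (use assms in \<open>auto simp: field_simps\<close>)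

text \<open>Exact, unlike the two decreasing branches: \<open>S_parabolic\<close> holds up to and
  including 1/2, and the exceptional point 0 is fixed and counted on both sides.\<close>

lemma cnt_parabolic:
  assumes "0 \<le> y" "y \<le> 1/2"
  shows "cnt (m + 1) (y / (1 + y)) = cnt m y"
proof -
  define \<phi> :: "real \<Rightarrow> real" where "\<phi> t = t / (1 + t)" for t
  have S: "S (\<phi> t) \<le> int (m + 1) \<longleftrightarrow> S t \<le> int m" if "t \<in> \<rat>" "0 \<le> t" "t \<le> y" for t
    using S_parabolic[of t] assms that by (cases "t = 0") (auto simp: \<phi>_def)
  have "\<phi> ` Zs m y = Zs (m + 1) (\<phi> y)"
  proof (intro set_eqI iffI)
    fix \<xi> assume "\<xi> \<in> \<phi> ` Zs m y"
    then obtain t where t: "t \<in> \<rat>" "0 \<le> t" "t \<le> y" "S t \<le> int m" "\<xi> = \<phi> t" by (auto simp: Zs_def)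
    then have "\<phi> t \<le> \<phi> y" by (simp add: \<phi>_def field_simps)
    then show "\<xi> \<in> Zs (m + 1) (\<phi> y)" using S[of t] t by (simp add: Zs_def) (simp add: \<phi>_def)
  next
    fix \<xi> assume "\<xi> \<in> Zs (m + 1) (\<phi> y)"
    then have \<xi>: "\<xi> \<in> \<rat>" "0 \<le> \<xi>" "\<xi> \<le> \<phi> y" "S \<xi> \<le> int (m + 1)" by (auto simp: Zs_def)
    have "\<phi> y < 1" using assms by (simp add: \<phi>_def field_simps)
    then have "\<xi> < 1" using \<xi> by simp
    define t where "t = \<xi> / (1 - \<xi>)"
    have t: "\<xi> = \<phi> t" using \<open>\<xi> < 1\<close> by (simp add: t_def \<phi>_def divide_simps)
    have "t \<in> \<rat>" "0 \<le> t" using \<xi> \<open>\<xi> < 1\<close> by (auto simp: t_def)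
    moreover have "t \<le> y"
      using \<xi>(3) \<open>0 \<le> t\<close> assms unfolding t by (simp add: \<phi>_def divide_simps) (simp add: algebra_simps)
    ultimately have "t \<in> Zs m y" using S[of t] \<xi> t by (auto simp: Zs_def)
    then show "\<xi> \<in> \<phi> ` Zs m y" using t by blast
  qed
  moreover have "inj_on \<phi> (Zs m y)"
    by (rule inj_onI) (auto simp: \<phi>_def Zs_def frac_eq_eq distrib_left mult.commute)
  ultimately show ?thesis unfolding cnt_def \<phi>_def by (metis card_image)
qed

lemma F_eq_lim:
  assumes "x \<le> 1"
  shows "F x = lim (\<lambda>n. cnt (n + 1) x / cnt (n + 1) 1)"
proof -
  have "{\<xi> \<in> Z n. \<xi> \<le> x} = Zs (n + 1) x" "Z n = Zs (n + 1) 1" for n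
    using assms by (auto simp: Z_def Zs_def)
  then show ?thesis by (simp add: F_def cnt_def)
qed

section \<open>Counts normalised by their growth rate, and their limits\<close>

definition acnt :: "nat \<Rightarrow> real \<Rightarrow> real" where
  "acnt m x = cnt m x * \<tau>^m"

lemma \<tau>_power_tendsto_0: "(\<lambda>m. \<tau>^m) \<longlonglongrightarrow> 0"
  using \<tau>_root \<tau>_less by (intro LIMSEQ_power_zero) auto

lemma error_tendsto_0:
  assumes "\<And>m. \<bar>e m\<bar> \<le> c"
  shows "(\<lambda>m. e m * \<tau>^m) \<longlonglongrightarrow> 0"
proof (rule Lim_null_comparison)
  show "\<forall>\<^sub>F m in sequentially. norm (e m * \<tau>^m) \<le> c * \<tau>^m"
    using assms \<tau>_root by (auto simp: abs_mult intro!: always_eventually mult_right_mono)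
  show "(\<lambda>m. c * \<tau>^m) \<longlonglongrightarrow> 0" using tendsto_mult_right_zero[OF \<tau>_power_tendsto_0] by simp
qed

text \<open>Split [0, 1/2] at 1/3. The left part is a parabolic copy of [0, 1/2]; the right part is
  an inverse copy of [0, 1], which splits into [0, 1/2] and its reflection. The digit sum rises by
  1, 2 and 3 respectively, which gives the tribonacci recurrence.\<close>

lemma acnt_half: "\<exists>l>0. (\<lambda>m. acnt m (1/2)) \<longlonglongrightarrow> l"
proof -
  \<comment> \<open>Discarding one point moves the error range from [-2, 2] to [0, 4], as the
    one-sided \<open>tribonacci_growth\<close> requires.\<close>
  define h where "h m = cnt m (1/2) - 1" for m
  have rec: "\<bar>cnt (m + 3) (1/2) - (cnt (m + 2) (1/2) + cnt (m + 1) (1/2) + cnt m (1/2))\<bar> \<le> 2" for m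
  proof -
    have "cnt (m + 3) (1/3) = cnt (m + 2) (1/2)"
      using cnt_parabolic[of "1/2" "m + 2"] by (simp add: numeral_3_eq_3)
    moreover have "\<bar>cnt (m + 3) (1/2) - cnt (m + 3) (1/3) - cnt (m + 1) 1\<bar> \<le> 1"
      using cnt_inverse[of 1 "m + 1"] by (simp add: numeral_3_eq_3)
    moreover have "\<bar>cnt (m + 1) 1 - cnt (m + 1) (1/2) - cnt m (1/2)\<bar> \<le> 1"
      using cnt_reflect[of "1/2" m] by simp
    ultimately show ?thesis by linarith
  qed
  have "\<exists>l>0. (\<lambda>m. h m * \<tau>^m) \<longlonglongrightarrow> l"
  proof (rule tribonacci_growth)
    show "h m \<ge> 0" for m using cnt_ge_1[of "1/2" m] by (simp add: h_def)
    show "h (m + 3) \<ge> h (m + 2) + h (m + 1) + h m" for m using rec[of m] by (simp add: h_def)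
    show "h (m + 3) \<le> h (m + 2) + h (m + 1) + h m + 4" for m using rec[of m] by (simp add: h_def)
    have "S (1/2) = 2" using S_inverse_add[of 0 2] by simp
    then have "{0, 1/2} \<subseteq> Zs 2 (1/2)" by (auto simp: Zs_def)
    then have "card {0, 1/2::real} \<le> card (Zs 2 (1/2))" by (intro card_mono finite_Zs) auto
    then show "h 2 > 0" by (simp add: h_def cnt_def)
  qed
  then obtain l where l: "l > 0" "(\<lambda>m. h m * \<tau>^m) \<longlonglongrightarrow> l" by blast
  have "(\<lambda>m. h m * \<tau>^m + \<tau>^m) \<longlonglongrightarrow> l + 0" by (intro tendsto_add l \<tau>_power_tendsto_0)
  moreover have "h m * \<tau>^m + \<tau>^m = acnt m (1/2)" for m by (simp add: acnt_def h_def left_diff_distrib)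
  ultimately show ?thesis using l(1) by auto
qed

lemma convergent_acnt_half: "convergent (\<lambda>m. acnt m (1/2))"
  using acnt_half unfolding convergent_def by blast

lemma acnt_branch:
  assumes "\<And>m. \<bar>cnt (m + j) w - cnt (m + j) x - cnt m y\<bar> \<le> 1"
  obtains e where "e \<longlonglongrightarrow> 0" "\<And>m. acnt (m + j) x = acnt (m + j) w - \<tau>^j * acnt m y + e m"
proof
  define r where "r m = (cnt (m + j) x - cnt (m + j) w + cnt m y) * \<tau>^j" for m
  show "(\<lambda>m. r m * \<tau>^m) \<longlonglongrightarrow> 0"
  proof (rule error_tendsto_0)
    fix m
    have "\<bar>cnt (m + j) x - cnt (m + j) w + cnt m y\<bar> \<le> 1" using assms[of m] by linarith
    then show "\<bar>r m\<bar> \<le> 1 * \<bar>\<tau>^j\<bar>" unfolding r_def abs_mult by (rule mult_right_mono) simp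
  qed
  show "acnt (m + j) x = acnt (m + j) w - \<tau>^j * acnt m y + r m * \<tau>^m" for m
    by (simp add: acnt_def r_def power_add algebra_simps)
qed

text \<open>Reflection at 1/2 expresses the count at 1 through counts at 1/2.\<close>

lemma convergent_acnt_1: "convergent (\<lambda>m. acnt m 1)"
proof -
  have *: "\<bar>cnt (m + 1) 1 - cnt (m + 1) (1/2) - cnt m (1/2)\<bar> \<le> 1" for m
    using cnt_reflect[of "1/2" m] by simp
  obtain e where e: "e \<longlonglongrightarrow> 0" "\<And>m. acnt (m + 1) (1/2) = acnt (m + 1) 1 - \<tau>^1 * acnt m (1/2) + e m"
    using acnt_branch[OF *] by blast
  obtain l where l: "(\<lambda>m. acnt m (1/2)) \<longlonglongrightarrow> l" using acnt_half by blast
  have "(\<lambda>m. acnt (m + 1) (1/2) + \<tau> * acnt m (1/2) - e m) \<longlonglongrightarrow> l + \<tau> * l - 0"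
    by (intro tendsto_intros e l LIMSEQ_ignore_initial_segment)
  then have "(\<lambda>m. acnt (m + 1) 1) \<longlonglongrightarrow> l + \<tau> * l" unfolding e(2) by simp
  then have "(\<lambda>m. acnt m 1) \<longlonglongrightarrow> l + \<tau> * l" by (rule LIMSEQ_offset)
  then show ?thesis unfolding convergent_def by blast
qed

text \<open>Each \<open>x\<close> is the image of another point of [0, 1] under the parabolic, the
  inverse or the reflecting map, according to its position relative to 1/3 and 1/2, and the counts
  of the two points are linked with a factor of size at most \<tau>.\<close>

lemma convergent_acnt:
  assumes "0 \<le> x" "x \<le> 1"
  shows "convergent (\<lambda>m. acnt m x)"
proof -
  obtain B where B: "\<And>m. \<bar>acnt m 1\<bar> \<le> B"
    using convergent_imp_Bseq[OF convergent_acnt_1] unfolding Bseq_def by auto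
  note t = \<tau>_root(1) \<tau>_less
  show ?thesis
  proof (rule convergent_contractive_recursion[where X = "{0..1}" and B = B])
    show "\<bar>acnt m y\<bar> \<le> B" if "y \<in> {0..1}" for m y
    proof -
      have "0 \<le> cnt m y" "cnt m y \<le> cnt m 1" using cnt_mono[of y 1 m] that by (auto simp: cnt_def)
      then have "\<bar>acnt m y\<bar> \<le> \<bar>acnt m 1\<bar>" using t by (auto simp: acnt_def abs_mult intro!: mult_right_mono)
      then show ?thesis using B[of m] by linarith
    qed
    \<comment> \<open>For the two decreasing maps, the count at the fixed endpoint \<open>w\<close>,
      known to converge, goes into \<open>r\<close> together with the vanishing error; the second
      recursive term is absent.\<close>
    have branch: "\<exists>i j r s s' y z. y \<in> {0..1} \<and> z \<in> {0..1} \<and> \<bar>s\<bar> + \<bar>s'\<bar> \<le> 8/10 \<and> convergent r \<and>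
        (\<forall>m. acnt (m + j) x = r m + s * acnt m y + s' * acnt (m + i) z)"
      if w: "convergent (\<lambda>m. acnt m w)" and "0 \<le> y" "y \<le> 1" "j > 0"
        and *: "\<And>m. \<bar>cnt (m + j) w - cnt (m + j) x - cnt m y\<bar> \<le> 1" for w x y j
    proof -
      obtain e where e: "e \<longlonglongrightarrow> 0" "\<And>m. acnt (m + j) x = acnt (m + j) w - \<tau>^j * acnt m y + e m"
        using acnt_branch[OF *] by blast
      have "\<tau>^j \<le> \<tau>^1" using t \<open>j > 0\<close> by (intro power_decreasing) auto
      then have "\<bar>- (\<tau>^j)\<bar> + \<bar>0::real\<bar> \<le> 8/10" using t by simp
      moreover have "convergent (\<lambda>m. acnt (m + j) w + e m)"
        using w e(1) convergent_ignore_initial_segment[of "\<lambda>m. acnt m w" j]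
        by (intro convergent_add) (auto simp: convergent_def)
      moreover have "\<forall>m. acnt (m + j) x = (acnt (m + j) w + e m) + - (\<tau>^j) * acnt m y + 0 * acnt (m + 0) y"
        using e by simp
      moreover have "y \<in> {0..1}" using that by simp
      ultimately show ?thesis by (intro exI conjI)
    qed
    show "\<exists>i j r s s' y z. y \<in> {0..1} \<and> z \<in> {0..1} \<and> \<bar>s\<bar> + \<bar>s'\<bar> \<le> 8/10 \<and> convergent r \<and>
        (\<forall>m. acnt (m + j) x = r m + s * acnt m y + s' * acnt (m + i) z)" if "x \<in> {0..1}" for x
    proof -
      consider "x \<le> 1/3" | "1/3 \<le> x" "x \<le> 1/2" | "1/2 \<le> x" by linarith
      then show ?thesis
      proof cases
        case 1
        define y where "y = x / (1 - x)"
        have y: "0 \<le> y" "y \<le> 1/2" "y / (1 + y) = x" using that 1 by (auto simp: y_def field_simps)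
        have "\<forall>m. acnt (m + 1) x = 0 + \<tau> * acnt m y + 0 * acnt (m + 0) y"
          using cnt_parabolic[OF y(1,2)] y(3) by (simp add: acnt_def)
        moreover have "\<bar>\<tau>\<bar> + \<bar>0::real\<bar> \<le> 8/10" "convergent (\<lambda>_::nat. 0::real)" "y \<in> {0..1}"
          using t y by (auto simp: convergent_const)
        ultimately show ?thesis by (intro exI conjI)
      next
        case 2
        show ?thesis
        proof (rule branch[OF convergent_acnt_half, where y = "1 / x - 2" and j = 2])
          show "\<bar>cnt (m + 2) (1/2) - cnt (m + 2) x - cnt m (1 / x - 2)\<bar> \<le> 1" for m
            using cnt_inverse[of "1 / x - 2" m] 2 by (simp add: field_simps)
        qed (use 2 in \<open>auto simp: field_simps\<close>)
      next
        case 3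
        show ?thesis
        proof (rule branch[OF convergent_acnt_1, where y = "1 - x" and j = 1])
          show "\<bar>cnt (m + 1) 1 - cnt (m + 1) x - cnt m (1 - x)\<bar> \<le> 1" for m
            using cnt_reflect[of "1 - x" m] 3 that by simp
        qed (use 3 that in auto)
      qed
    qed
  qed (use assms in auto)
qed

text \<open>\<open>glim\<close> is \<open>F\<close> before normalisation.\<close>

definition glim :: "real \<Rightarrow> real" where
  "glim x = lim (\<lambda>m. acnt m x)"

lemma acnt_tendsto:
  assumes "0 \<le> x" "x \<le> 1"
  shows "(\<lambda>m. acnt m x) \<longlonglongrightarrow> glim x"
  using convergent_acnt[OF assms] by (simp add: glim_def convergent_LIMSEQ_iff)

lemma glim_mono:
  assumes "0 \<le> x" "x \<le> y" "y \<le> 1"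
  shows "glim x \<le> glim y"
  by (rule LIMSEQ_le[OF acnt_tendsto acnt_tendsto])
    (use assms \<tau>_root in \<open>auto simp: acnt_def intro!: mult_right_mono cnt_mono\<close>)

lemma glim_1_pos: "glim 1 > 0"
proof -
  obtain l where "l > 0" "(\<lambda>m. acnt m (1/2)) \<longlonglongrightarrow> l" using acnt_half by blast
  moreover have "(\<lambda>m. acnt m (1/2)) \<longlonglongrightarrow> glim (1/2)" by (rule acnt_tendsto) auto
  ultimately have "glim (1/2) > 0" using LIMSEQ_unique by blast
  then show ?thesis using glim_mono[of "1/2" 1] by simp
qed

lemma glim_branch:
  assumes "\<And>m. \<bar>cnt (m + j) w - cnt (m + j) x - cnt m y\<bar> \<le> 1"
    and "x \<in> {0..1}" "y \<in> {0..1}" "w \<in> {0..1}"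
  shows "glim x = glim w - \<tau>^j * glim y"
proof -
  obtain e where e: "e \<longlonglongrightarrow> 0" "\<And>m. acnt (m + j) x = acnt (m + j) w - \<tau>^j * acnt m y + e m"
    using acnt_branch[OF assms(1)] by blast
  have "(\<lambda>m. acnt (m + j) x) \<longlonglongrightarrow> glim w - \<tau>^j * glim y + 0"
    unfolding e(2) using assms(2-)
    by (intro tendsto_intros e LIMSEQ_ignore_initial_segment acnt_tendsto) auto
  then have "(\<lambda>m. acnt (m + j) x) \<longlonglongrightarrow> glim w - \<tau>^j * glim y" by simp
  moreover have "(\<lambda>m. acnt (m + j) x) \<longlonglongrightarrow> glim x"
    using assms(2) by (intro LIMSEQ_ignore_initial_segment acnt_tendsto) auto
  ultimately show ?thesis using LIMSEQ_unique by blast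
qed

section \<open>Functional equations of \<open>F\<close>\<close>

lemma F_eq_glim:
  assumes "0 \<le> x" "x \<le> 1"
  shows "F x = glim x / glim 1"
proof -
  have "(\<lambda>n. acnt (n + 1) x / acnt (n + 1) 1) \<longlonglongrightarrow> glim x / glim 1"
    using assms glim_1_pos
    by (intro tendsto_divide LIMSEQ_ignore_initial_segment acnt_tendsto) auto
  moreover have "acnt (n + 1) x / acnt (n + 1) 1 = cnt (n + 1) x / cnt (n + 1) 1" for n
    using \<tau>_root by (simp add: acnt_def)
  ultimately show ?thesis using F_eq_lim[of x] assms limI by simp
qed

lemma F_1: "F 1 = 1"
  using F_eq_glim[of 1] glim_1_pos by simp

lemma F_mono:
  assumes "0 \<le> x" "x \<le> y" "y \<le> 1"
  shows "F x \<le> F y"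
  using assms glim_mono[OF assms] glim_1_pos by (simp add: F_eq_glim divide_right_mono)

lemma F_reflect:
  assumes "0 \<le> y" "y \<le> 1/2"
  shows "F (1 - y) = 1 - \<tau> * F y"
proof -
  have "glim (1 - y) = glim 1 - \<tau>^1 * glim y"
    using assms cnt_reflect by (intro glim_branch) auto
  then show ?thesis using assms glim_1_pos by (simp add: F_eq_glim diff_divide_distrib)
qed

lemma F_inverse_2:
  assumes "0 \<le> y" "y \<le> 1"
  shows "F (1 / (2 + y)) = F (1/2) - \<tau>^2 * F y"
proof -
  have "glim (1 / (2 + y)) = glim (1/2) - \<tau>^2 * glim y"
    using assms cnt_inverse by (intro glim_branch) auto
  then show ?thesis using assms by (simp add: F_eq_glim diff_divide_distrib)
qed

lemma F_parabolic:
  assumes "0 \<le> y" "y \<le> 1/2"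
  shows "F (y / (1 + y)) = \<tau> * F y"
proof -
  have y': "0 \<le> y / (1 + y)" "y / (1 + y) \<le> 1" using assms by auto
  have "acnt (m + 1) (y / (1 + y)) = \<tau> * acnt m y" for m
    using cnt_parabolic[OF assms] by (simp add: acnt_def)
  then have "(\<lambda>m. \<tau> * acnt m y) \<longlonglongrightarrow> glim (y / (1 + y))"
    using LIMSEQ_ignore_initial_segment[OF acnt_tendsto[OF y'], of 1] by simp
  moreover have "(\<lambda>m. \<tau> * acnt m y) \<longlonglongrightarrow> \<tau> * glim y"
    using assms by (intro tendsto_intros acnt_tendsto) auto
  ultimately have "glim (y / (1 + y)) = \<tau> * glim y" by (rule LIMSEQ_unique)
  then show ?thesis using y' assms by (simp add: F_eq_glim)
qed

lemma F_0: "F 0 = 0"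
  using F_parabolic[of 0] \<tau>_less by simp

lemma F_half_pos: "F (1/2) > 0"
proof -
  have "F (1/2) = 1 - \<tau> * F (1/2)" using F_reflect[of "1/2"] by simp
  then have "F (1/2) * (1 + \<tau>) > 0" by (simp add: algebra_simps)
  then show ?thesis using \<tau>_root(1) by (simp add: zero_less_mult_iff)
qed

section \<open>Branches, distortion and the cross ratio\<close>

text \<open>Each parabolic step takes \<open>1 / (n + 2)\<close> to the next reciprocal and costs a
  factor \<tau>. Geometric decay of \<open>F\<close> against harmonic decay of the distance to 0 is
  what \<open>derivative_at_endpoint\<close> exploits.\<close>

lemma F_reciprocal: "F (1 / (real n + 2)) = \<tau>^n * F (1/2)"
proof (induction n)
  case (Suc n)
  have "1 / (real (Suc n) + 2) = (1 / (real n + 2)) / (1 + 1 / (real n + 2))"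
    by (simp add: field_simps)
  also have "F \<dots> = \<tau> * F (1 / (real n + 2))" by (rule F_parabolic) (auto simp: field_simps)
  finally show ?case using Suc by simp
qed simp

lemma F_inverse:
  assumes "2 \<le> n" "0 \<le> y" "y \<le> 1"
  shows "F (1 / (real n + y)) = F (1 / real n) - \<tau>^n * F y"
  using assms(1)
proof (induction n rule: dec_induct)
  case base
  then show ?case using F_inverse_2 assms by simp
next
  case (step n)
  have pos: "real n + y \<ge> 2" using step assms by simp
  have "1 / (real (Suc n) + y) = (1 / (real n + y)) / (1 + 1 / (real n + y))"
    using pos by (simp add: field_simps)
  also have "F \<dots> = \<tau> * F (1 / (real n + y))"
    using pos by (intro F_parabolic) (auto simp: field_simps)
  finally have 1: "F (1 / (real (Suc n) + y)) = \<tau> * F (1 / (real n + y))" .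
  have "1 / real (Suc n) = (1 / real n) / (1 + 1 / real n)"
    using step by (simp add: field_simps)
  also have "F \<dots> = \<tau> * F (1 / real n)"
    using step by (intro F_parabolic) (auto simp: field_simps)
  finally show ?case using 1 step.IH by (simp add: right_diff_distrib)
qed

text \<open>
  \<open>cylinder k M\<close> abstracts a composition of \<open>k\<close> branches \<open>t \<mapsto> 1/(n+t)\<close> and \<open>t \<mapsto> 1 - 1/(n+t)\<close>, a
  Moebius map with denominator \<open>c * t + d\<close> and determinant \<open>\<plusminus>1\<close>.
\<close>

definition cylinder :: "nat \<Rightarrow> (real \<Rightarrow> real) \<Rightarrow> bool" where
  "cylinder k M \<longleftrightarrow> (\<exists>c d \<alpha> \<beta>. 0 \<le> c \<and> c \<le> d \<and> 2^k \<le> d \<and> \<beta> \<noteq> 0 \<and> M ` {0..1} \<subseteq> {0..1} \<and>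
     (\<forall>t\<in>{0..1}. F (M t) = \<alpha> + \<beta> * F t) \<and>
     (\<forall>s\<in>{0..1}. \<forall>t\<in>{0..1}. \<bar>M s - M t\<bar> = \<bar>s - t\<bar> / ((c * s + d) * (c * t + d))))"

lemma cylinderE:
  assumes "cylinder k M"
  obtains c d \<alpha> \<beta> where "0 \<le> c" "c \<le> d" "2^k \<le> d" "\<beta> \<noteq> 0"
    "\<And>t. 0 \<le> t \<Longrightarrow> t \<le> 1 \<Longrightarrow> 0 \<le> M t \<and> M t \<le> 1"
    "\<And>t. 0 \<le> t \<Longrightarrow> t \<le> 1 \<Longrightarrow> F (M t) = \<alpha> + \<beta> * F t"
    "\<And>s t. 0 \<le> s \<Longrightarrow> s \<le> 1 \<Longrightarrow> 0 \<le> t \<Longrightarrow> t \<le> 1 \<Longrightarrow>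
       \<bar>M s - M t\<bar> = \<bar>s - t\<bar> / ((c * s + d) * (c * t + d))"
proof -
  from assms obtain c d \<alpha> \<beta> where *: "0 \<le> c" "c \<le> d" "2^k \<le> d" "\<beta> \<noteq> 0" "M ` {0..1} \<subseteq> {0..1}"
     "\<forall>t\<in>{0..1}. F (M t) = \<alpha> + \<beta> * F t"
     "\<forall>s\<in>{0..1}. \<forall>t\<in>{0..1}. \<bar>M s - M t\<bar> = \<bar>s - t\<bar> / ((c * s + d) * (c * t + d))"
    unfolding cylinder_def by blast
  show thesis
    by (rule that[of c d \<beta> \<alpha>]) (use * in \<open>auto simp: image_subset_iff\<close>)
qed

lemma cylinderI:
  assumes "0 \<le> c" "c \<le> d" "2^k \<le> d" "\<beta> \<noteq> 0"
    "\<And>t. 0 \<le> t \<Longrightarrow> t \<le> 1 \<Longrightarrow> 0 \<le> M t \<and> M t \<le> 1"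
    "\<And>t. 0 \<le> t \<Longrightarrow> t \<le> 1 \<Longrightarrow> F (M t) = \<alpha> + \<beta> * F t"
    "\<And>s t. 0 \<le> s \<Longrightarrow> s \<le> 1 \<Longrightarrow> 0 \<le> t \<Longrightarrow> t \<le> 1 \<Longrightarrow>
       \<bar>M s - M t\<bar> = \<bar>s - t\<bar> / ((c * s + d) * (c * t + d))"
  shows "cylinder k M"
  unfolding cylinder_def
  by (rule exI[of _ c], rule exI[of _ d], rule exI[of _ \<alpha>], rule exI[of _ \<beta>]) (use assms in auto)

lemma cylinder_id: "cylinder 0 (\<lambda>t. t)"
  by (rule cylinderI[of 0 1 0 1 _ 0]) auto

lemma cylinder_inverse:
  assumes "cylinder k M" "2 \<le> n"
  shows "cylinder (Suc k) (\<lambda>t. M (1 / (real n + t)))"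
  using assms(1)
proof (rule cylinderE)
  fix c d \<alpha> \<beta> assume M: "0 \<le> c" "c \<le> d" "2^k \<le> d" "\<beta> \<noteq> 0"
    "\<And>t. 0 \<le> t \<Longrightarrow> t \<le> 1 \<Longrightarrow> 0 \<le> M t \<and> M t \<le> 1"
    "\<And>t. 0 \<le> t \<Longrightarrow> t \<le> 1 \<Longrightarrow> F (M t) = \<alpha> + \<beta> * F t"
    "\<And>s t. 0 \<le> s \<Longrightarrow> s \<le> 1 \<Longrightarrow> 0 \<le> t \<Longrightarrow> t \<le> 1 \<Longrightarrow>
       \<bar>M s - M t\<bar> = \<bar>s - t\<bar> / ((c * s + d) * (c * t + d))"
  have n: "real n \<ge> 2" using assms(2) by simp
  have d: "d > 0" using M(3) by (rule less_le_trans[rotated]) simp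
  have b: "0 \<le> 1 / (real n + t)" "1 / (real n + t) \<le> 1" if "0 \<le> t" for t
    using that n by auto
  have nd: "real n * d \<ge> 2 * d" using n d by simp
  \<comment> \<open>Substituting \<open>1 / (n + t)\<close> into \<open>c * t + d\<close> and
    clearing \<open>n + t\<close> gives the new denominator \<open>d * t + (c + n * d)\<close>;
    \<open>n \<ge> 2\<close> doubles the lower bound on \<open>d\<close>.\<close>
  show ?thesis
  proof (rule cylinderI[of d "c + real n * d" _ "- (\<beta> * \<tau>^n)" _ "\<alpha> + \<beta> * F (1 / real n)"])
    show "2 ^ Suc k \<le> c + real n * d" "d \<le> c + real n * d"
      using nd M(1,3) d unfolding power_Suc by linarith+
    show "F (M (1 / (real n + t))) = \<alpha> + \<beta> * F (1 / real n) + - (\<beta> * \<tau>^n) * F t"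
      if "0 \<le> t" "t \<le> 1" for t
      unfolding M(6)[OF b[OF that(1)]] F_inverse[OF assms(2) that] by (simp add: algebra_simps)
    show "\<bar>M (1 / (real n + s)) - M (1 / (real n + t))\<bar> =
        \<bar>s - t\<bar> / ((d * s + (c + real n * d)) * (d * t + (c + real n * d)))"
      if st: "0 \<le> s" "s \<le> 1" "0 \<le> t" "t \<le> 1" for s t
    proof -
      have p: "real n + s > 0" "real n + t > 0" using n st by auto
      have "1 / (real n + s) - 1 / (real n + t) = (t - s) / ((real n + s) * (real n + t))"
        using p by (simp add: field_simps)
      then have "\<bar>1 / (real n + s) - 1 / (real n + t)\<bar> = \<bar>s - t\<bar> / ((real n + s) * (real n + t))"
        using p by (simp add: abs_mult abs_minus_commute)
      moreover have "c * (1 / (real n + s)) + d = (d * s + (c + real n * d)) / (real n + s)"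
        "c * (1 / (real n + t)) + d = (d * t + (c + real n * d)) / (real n + t)"
        using p by (simp_all add: field_simps)
      ultimately show ?thesis
        using M(7)[OF b[OF st(1)] b[OF st(3)]] p by simp
    qed
  qed (use M b \<tau>_root(1) d in auto)
qed

lemma cylinder_reflect_inverse:
  assumes "cylinder k M" "2 \<le> n"
  shows "cylinder (Suc k) (\<lambda>t. M (1 - 1 / (real n + t)))"
  using assms(1)
proof (rule cylinderE)
  fix c d \<alpha> \<beta> assume M: "0 \<le> c" "c \<le> d" "2^k \<le> d" "\<beta> \<noteq> 0"
    "\<And>t. 0 \<le> t \<Longrightarrow> t \<le> 1 \<Longrightarrow> 0 \<le> M t \<and> M t \<le> 1"
    "\<And>t. 0 \<le> t \<Longrightarrow> t \<le> 1 \<Longrightarrow> F (M t) = \<alpha> + \<beta> * F t"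
    "\<And>s t. 0 \<le> s \<Longrightarrow> s \<le> 1 \<Longrightarrow> 0 \<le> t \<Longrightarrow> t \<le> 1 \<Longrightarrow>
       \<bar>M s - M t\<bar> = \<bar>s - t\<bar> / ((c * s + d) * (c * t + d))"
  have n: "real n \<ge> 2" using assms(2) by simp
  have d: "d > 0" using M(3) by (rule less_le_trans[rotated]) simp
  have b: "0 \<le> 1 - 1 / (real n + t)" "1 - 1 / (real n + t) \<le> 1" "1 / (real n + t) \<le> 1/2"
      "0 \<le> 1 / (real n + t)" if "0 \<le> t" for t
    using that n by (auto simp: field_simps)
  have nd: "real n * (c + d) \<ge> 2 * (c + d)" using n d M(1) by (intro mult_right_mono) auto
  \<comment> \<open>The constant term of the new denominator: clearing \<open>n + t\<close> in
    \<open>c * (1 - 1 / (n + t)) + d\<close> gives \<open>(c + d) * t + e\<close>.\<close>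
  define e where "e = real n * (c + d) - c"
  have e: "e \<ge> c + 2 * d" using nd unfolding e_def by simp
  show ?thesis
  proof (rule cylinderI[of "c + d" e _ "\<beta> * \<tau> * \<tau>^n" _ "\<alpha> + \<beta> - \<beta> * \<tau> * F (1 / real n)"])
    show "2 ^ Suc k \<le> e" "c + d \<le> e"
      using e M(1,3) d unfolding power_Suc by linarith+
    show "F (M (1 - 1 / (real n + t))) = \<alpha> + \<beta> - \<beta> * \<tau> * F (1 / real n) + \<beta> * \<tau> * \<tau>^n * F t"
      if "0 \<le> t" "t \<le> 1" for t
      unfolding M(6)[OF b(1,2)[OF that(1)]] F_reflect[OF b(4,3)[OF that(1)]] F_inverse[OF assms(2) that]
      by (simp add: algebra_simps)
    show "\<bar>M (1 - 1 / (real n + s)) - M (1 - 1 / (real n + t))\<bar> =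
        \<bar>s - t\<bar> / (((c + d) * s + e) * ((c + d) * t + e))"
      if st: "0 \<le> s" "s \<le> 1" "0 \<le> t" "t \<le> 1" for s t
    proof -
      have p: "real n + s > 0" "real n + t > 0" using n st by auto
      have "(1 - 1 / (real n + s)) - (1 - 1 / (real n + t)) = (s - t) / ((real n + s) * (real n + t))"
        using p by (simp add: field_simps)
      then have "\<bar>(1 - 1 / (real n + s)) - (1 - 1 / (real n + t))\<bar> =
          \<bar>s - t\<bar> / ((real n + s) * (real n + t))"
        using p by (simp add: abs_mult)
      moreover have "c * (1 - 1 / (real n + s)) + d = ((c + d) * s + e) / (real n + s)"
        "c * (1 - 1 / (real n + t)) + d = ((c + d) * t + e) / (real n + t)"
        using p by (simp_all add: e_def field_simps)
      ultimately show ?thesis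
        using M(7)[OF b(1,2)[OF st(1)] b(1,2)[OF st(3)]] p by simp
    qed
  qed (use M b \<tau>_root(1) d in auto)
qed

text \<open>As long as \<open>x\<close> is never an endpoint image, its parameter \<open>t\<close>
  is interior and can be expanded once more, by the inverse branch if \<open>t \<le> 1/2\<close> and
  by the reflected one otherwise. The new parameter is below 1, and 0 would make \<open>x\<close> an
  endpoint image.\<close>

lemma cylinder_dichotomy:
  assumes "0 \<le> x" "x \<le> 1"
  shows "(\<exists>k M. cylinder k M \<and> (x = M 0 \<or> x = M 1)) \<or>
    (\<forall>k. \<exists>M t. cylinder k M \<and> 0 < t \<and> t < 1 \<and> x = M t)"
proof (cases "\<exists>k M. cylinder k M \<and> (x = M 0 \<or> x = M 1)")
  case False
  have "\<exists>M t. cylinder k M \<and> 0 < t \<and> t < 1 \<and> x = M t" for k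
  proof (induction k)
    case 0
    have "x \<noteq> 0" "x \<noteq> 1" using False cylinder_id by blast+
    then show ?case using cylinder_id assms by (intro exI[of _ "\<lambda>t. t"] exI[of _ x]) auto
  next
    case (Suc k)
    then obtain M t where M: "cylinder k M" "0 < t" "t < 1" "x = M t" by blast
    have "\<exists>M' s. cylinder (Suc k) M' \<and> 0 \<le> s \<and> s < 1 \<and> x = M' s"
    proof (cases "t \<le> 1/2")
      case True
      then obtain n s where s: "n \<ge> 2" "0 \<le> s" "s < 1" "t = 1 / (of_int n + s)"
        using inverse_decomp[of t] M by metis
      then show ?thesis using cylinder_inverse[OF M(1), of "nat n"] M(4)
        by (intro exI[of _ "\<lambda>t. M (1 / (real (nat n) + t))"] exI[of _ s]) auto
    next
      case False
      then obtain n s where s: "n \<ge> 2" "0 \<le> s" "s < 1" "1 - t = 1 / (of_int n + s)"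
        using inverse_decomp[of "1 - t"] M by (metis diff_gt_0_iff_gt diff_le_eq field_sum_of_halves
            add.commute linorder_not_le le_diff_eq less_eq_real_def)
      then have t: "t = 1 - 1 / (real (nat n) + s)" by simp
      have "cylinder (Suc k) (\<lambda>t. M (1 - 1 / (real (nat n) + t)))"
        using cylinder_reflect_inverse[OF M(1), of "nat n"] s(1) by simp
      then show ?thesis using M(4) s(2,3) unfolding t by blast
    qed
    then obtain M' s where "cylinder (Suc k) M'" "0 \<le> s" "s < 1" "x = M' s" by blast
    moreover from this have "s \<noteq> 0" using False by blast
    ultimately show ?case by (metis less_eq_real_def)
  qed
  then show ?thesis by blast
qed blast

text \<open>Since the limit \<open>L\<close> is assumed to exist, one sequence approaching
  \<open>M e\<close> determines it. Along it the difference quotients are bounded by a constant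
  times \<open>(n + 2) * \<tau>^n\<close>.\<close>

lemma derivative_at_endpoint:
  assumes "cylinder k M" and e: "e = 0 \<or> e = 1"
    and L: "has_ext_derivative F L (M e) {0..1}"
  shows "L = 0"
  using assms(1)
proof (rule cylinderE)
  fix c d \<alpha> \<beta> assume M: "0 \<le> c" "c \<le> d" "2^k \<le> d" "\<beta> \<noteq> 0"
    "\<And>t. 0 \<le> t \<Longrightarrow> t \<le> 1 \<Longrightarrow> 0 \<le> M t \<and> M t \<le> 1"
    "\<And>t. 0 \<le> t \<Longrightarrow> t \<le> 1 \<Longrightarrow> F (M t) = \<alpha> + \<beta> * F t"
    "\<And>s t. 0 \<le> s \<Longrightarrow> s \<le> 1 \<Longrightarrow> 0 \<le> t \<Longrightarrow> t \<le> 1 \<Longrightarrow>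
       \<bar>M s - M t\<bar> = \<bar>s - t\<bar> / ((c * s + d) * (c * t + d))"
  have d: "d > 0" using M(3) by (rule less_le_trans[rotated]) simp
  \<comment> \<open>Parameters tending to \<open>e\<close> from inside [0, 1] at which
    \<open>F\<close> is known explicitly.\<close>
  define s where "s n = (if e = 0 then 1 / (real n + 2) else 1 - 1 / (real n + 2))" for n
  have s: "0 \<le> s n" "s n \<le> 1" "\<bar>s n - e\<bar> = 1 / (real n + 2)" for n
  proof -
    have "0 < 1 / (real n + 2)" "1 / (real n + 2) \<le> 1" by auto
    then show "0 \<le> s n" "s n \<le> 1" "\<bar>s n - e\<bar> = 1 / (real n + 2)" using e by (auto simp: s_def)
  qed
  have e01: "0 \<le> e" "e \<le> 1" using e by auto
  have Fs: "\<bar>F (s n) - F e\<bar> \<le> \<tau>^n * F (1/2)" for n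
  proof (cases "e = 0")
    case True
    then show ?thesis using F_reciprocal[of n] F_0 F_half_pos \<tau>_root(1) by (simp add: s_def)
  next
    case False
    have "F (s n) = 1 - \<tau> * (\<tau>^n * F (1/2))"
      using F_reflect[of "1 / (real n + 2)"] F_reciprocal[of n] False by (simp add: s_def field_simps)
    moreover have "\<tau> * (\<tau>^n * F (1/2)) \<le> 1 * (\<tau>^n * F (1/2))"
      using \<tau>_root(1) \<tau>_less F_half_pos by (intro mult_right_mono) auto
    moreover have "\<tau> * (\<tau>^n * F (1/2)) \<ge> 0" using \<tau>_root(1) F_half_pos by simp
    ultimately show ?thesis using False e F_1 by simp
  qed
  \<comment> \<open>Bounded distortion: \<open>c \<le> d\<close> keeps each denominator factor
    between \<open>d\<close> and \<open>2 * d\<close>.\<close>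
  have den: "d^2 \<le> (c * s n + d) * (c * e + d)" "(c * s n + d) * (c * e + d) \<le> 4 * d^2" for n
  proof -
    have "0 \<le> c * s n" "0 \<le> c * e" "c * s n \<le> c" "c * e \<le> c"
      using M(1) s[of n] e01 by (auto intro: mult_left_le)
    then have "d \<le> c * s n + d" "d \<le> c * e + d" "c * s n + d \<le> 2 * d" "c * e + d \<le> 2 * d"
      using M(2) by auto
    then have "d * d \<le> (c * s n + d) * (c * e + d)" "(c * s n + d) * (c * e + d) \<le> (2 * d) * (2 * d)"
      using d by (intro mult_mono; linarith)+
    then show "d^2 \<le> (c * s n + d) * (c * e + d)" "(c * s n + d) * (c * e + d) \<le> 4 * d^2"
      by (auto simp: power2_eq_square)
  qed
  have dist: "\<bar>M (s n) - M e\<bar> = 1 / (real n + 2) / ((c * s n + d) * (c * e + d))" for n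
    using M(7)[OF s(1,2)[of n] e01] s(3)[of n] by simp
  have lower: "\<bar>M (s n) - M e\<bar> \<ge> 1 / (real n + 2) / (4 * d^2)" for n
  proof -
    have "0 < (c * s n + d) * (c * e + d)" using den(1)[of n] d by (meson less_le_trans zero_less_power)
    then show ?thesis unfolding dist using den(2)[of n] d by (intro frac_le) auto
  qed
  have upper: "\<bar>M (s n) - M e\<bar> \<le> 1 / (real n + 2) / d^2" for n
  proof -
    have "0 < (c * s n + d) * (c * e + d)" using den(1)[of n] d by (meson less_le_trans zero_less_power)
    then show ?thesis unfolding dist using den(1)[of n] d by (intro frac_le) auto
  qed
  have pos: "\<bar>M (s n) - M e\<bar> > 0" for n
  proof -
    have "0 < 1 / (real n + 2) / (4 * d^2)" using d by simp
    then show ?thesis using lower[of n] by linarith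
  qed
  have "(\<lambda>n. M (s n) - M e) \<longlonglongrightarrow> 0"
  proof (rule Lim_null_comparison)
    show "\<forall>\<^sub>F n in sequentially. norm (M (s n) - M e) \<le> 1 / (real n + 2) / d^2"
      using upper by (auto intro: always_eventually)
    have "(\<lambda>n. 1 / (real (n + 2)) * (1 / d^2)) \<longlonglongrightarrow> 0 * (1 / d^2)"
      by (intro tendsto_mult tendsto_const LIMSEQ_ignore_initial_segment lim_1_over_n)
    then show "(\<lambda>n. 1 / (real n + 2) / d^2) \<longlonglongrightarrow> 0" by (simp add: add.commute)
  qed
  then have lim: "(\<lambda>n. M (s n)) \<longlonglongrightarrow> M e" by (simp add: LIM_zero_iff)
  have "filterlim (\<lambda>n. M (s n)) (at (M e) within {0..1}) sequentially"
    unfolding filterlim_at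
  proof (intro conjI always_eventually allI lim)
    show "M (s n) \<in> {0..1}" "M (s n) \<noteq> M e" for n using M(5)[OF s(1,2)] pos[of n] by auto
  qed
  then have 1: "(\<lambda>n. ereal ((F (M (s n)) - F (M e)) / (M (s n) - M e))) \<longlonglongrightarrow> L"
    using L unfolding has_ext_derivative_def by (rule filterlim_compose[rotated])
  have "(\<lambda>n. (F (M (s n)) - F (M e)) / (M (s n) - M e)) \<longlonglongrightarrow> 0"
  proof (rule Lim_null_comparison)
    let ?K = "\<bar>\<beta>\<bar> * F (1/2) * (4 * d^2)"
    have "norm ((F (M (s n)) - F (M e)) / (M (s n) - M e)) \<le> ?K * ((real n + 2) * \<tau>^n)" for n
    proof -
      have "F (M (s n)) - F (M e) = \<beta> * (F (s n) - F e)"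
        using M(6)[OF s(1,2)[of n]] M(6)[OF e01] by (simp add: right_diff_distrib)
      then have "norm ((F (M (s n)) - F (M e)) / (M (s n) - M e)) =
          \<bar>\<beta>\<bar> * \<bar>F (s n) - F e\<bar> / \<bar>M (s n) - M e\<bar>" by (simp add: abs_mult)
      also have "\<dots> \<le> \<bar>\<beta>\<bar> * (\<tau>^n * F (1/2)) / (1 / (real n + 2) / (4 * d^2))"
        using Fs[of n] lower[of n] d \<tau>_root(1) F_half_pos
        by (intro frac_le mult_left_mono) auto
      also have "\<dots> = ?K * ((real n + 2) * \<tau>^n)" by simp
      finally show ?thesis .
    qed
    then show "\<forall>\<^sub>F n in sequentially.
        norm ((F (M (s n)) - F (M e)) / (M (s n) - M e)) \<le> ?K * ((real n + 2) * \<tau>^n)"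
      by (auto intro: always_eventually)
    have "(\<lambda>n. real n * \<tau>^n) \<longlonglongrightarrow> 0"
      using powser_times_n_limit_0[of \<tau>] \<tau>_root(1) \<tau>_less by simp
    then have "(\<lambda>n. ?K * (real n * \<tau>^n + 2 * \<tau>^n)) \<longlonglongrightarrow> ?K * (0 + 2 * 0)"
      by (intro tendsto_intros \<tau>_power_tendsto_0)
    then show "(\<lambda>n. ?K * ((real n + 2) * \<tau>^n)) \<longlonglongrightarrow> 0" by (simp add: distrib_right)
  qed
  then have "(\<lambda>n. ereal ((F (M (s n)) - F (M e)) / (M (s n) - M e))) \<longlonglongrightarrow> ereal 0" by simp
  with 1 show "L = 0" using LIMSEQ_unique zero_ereal_def by metis
qed

text \<open>The chords need not start at \<open>x\<close>. Linearise \<open>f\<close> at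
  \<open>x\<close> for both ends and subtract: the errors are small compared with the distances to
  \<open>x\<close>, hence by the hypotheses on \<open>C\<close> small compared with the
  chord.\<close>

lemma chord_slope_tendsto:
  fixes f :: "real \<Rightarrow> real"
  assumes D: "(f has_real_derivative D) (at x within A)"
    and mem: "\<And>k. y k \<in> A" "\<And>k. z k \<in> A" "\<And>k. y k \<noteq> z k"
    and lim: "y \<longlonglongrightarrow> x" "z \<longlonglongrightarrow> x"
    and C: "\<And>k. \<bar>y k - x\<bar> \<le> C * \<bar>y k - z k\<bar>" "\<And>k. \<bar>z k - x\<bar> \<le> C * \<bar>y k - z k\<bar>"
  shows "(\<lambda>k. (f (y k) - f (z k)) / (y k - z k)) \<longlonglongrightarrow> D"
proof (rule tendstoI)
  fix \<epsilon> :: real assume "\<epsilon> > 0"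
  define K where "K = 2 * \<bar>C\<bar> + 1"
  have "K > 0" by (simp add: K_def)
  then have "\<epsilon> / (2 * K) > 0" using \<open>\<epsilon> > 0\<close> by simp
  then obtain \<delta> where \<delta>: "\<delta> > 0"
    "\<And>v. v \<in> A \<Longrightarrow> \<bar>v - x\<bar> < \<delta> \<Longrightarrow> \<bar>f v - f x - D * (v - x)\<bar> \<le> \<epsilon> / (2 * K) * \<bar>v - x\<bar>"
    using D unfolding has_field_derivative_def has_derivative_within_alt by (auto simp: mult.commute)
  have "eventually (\<lambda>k. \<bar>y k - x\<bar> < \<delta>) sequentially" "eventually (\<lambda>k. \<bar>z k - x\<bar> < \<delta>) sequentially"
    using lim \<delta>(1) by (auto dest: tendstoD simp: dist_real_def)
  then show "eventually (\<lambda>k. dist ((f (y k) - f (z k)) / (y k - z k)) D < \<epsilon>) sequentially"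
  proof eventually_elim
    case (elim k)
    let ?h = "\<bar>y k - z k\<bar>"
    have h: "?h > 0" using mem(3)[of k] by simp
    have "\<bar>y k - x\<bar> + \<bar>z k - x\<bar> \<le> K * ?h"
    proof -
      have "C * ?h \<le> \<bar>C\<bar> * ?h" by (intro mult_right_mono) auto
      moreover have "K * ?h = 2 * (\<bar>C\<bar> * ?h) + ?h" by (simp add: K_def distrib_right)
      ultimately show ?thesis using C[of k] h by linarith
    qed
    then have "\<epsilon> / (2 * K) * (\<bar>y k - x\<bar> + \<bar>z k - x\<bar>) \<le> \<epsilon> / (2 * K) * (K * ?h)"
      using \<open>\<epsilon> / (2 * K) > 0\<close> by (intro mult_left_mono) auto
    also have "\<dots> = \<epsilon> / 2 * ?h" using \<open>K > 0\<close> by simp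
    finally have "\<epsilon> / (2 * K) * \<bar>y k - x\<bar> + \<epsilon> / (2 * K) * \<bar>z k - x\<bar> \<le> \<epsilon> / 2 * ?h"
      by (simp only: distrib_left)
    moreover have "f (y k) - f (z k) - D * (y k - z k) =
        (f (y k) - f x - D * (y k - x)) - (f (z k) - f x - D * (z k - x))"
      by (simp add: algebra_simps)
    ultimately have "\<bar>f (y k) - f (z k) - D * (y k - z k)\<bar> \<le> \<epsilon> / 2 * ?h"
      using \<delta>(2)[OF mem(1) elim(1)] \<delta>(2)[OF mem(2) elim(2)] by linarith
    also have "\<dots> < \<epsilon> * ?h" using h \<open>\<epsilon> > 0\<close> by simp
    finally have "\<bar>f (y k) - f (z k) - D * (y k - z k)\<bar> / ?h < \<epsilon>" using h by (simp add: divide_less_eq)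
    moreover have "(f (y k) - f (z k)) / (y k - z k) - D = (f (y k) - f (z k) - D * (y k - z k)) / (y k - z k)"
      using mem(3)[of k] by (simp add: diff_divide_distrib)
    ultimately show ?case by (simp add: dist_real_def)
  qed
qed

text \<open>Bounded distortion meets the hypotheses of \<open>chord_slope_tendsto\<close>: every
  image point lies within \<open>1 / d^2\<close> of \<open>x\<close>, while the images of
  \<open>p\<close> and \<open>q\<close> are at least \<open>\<bar>p - q\<bar> / (4 * d^2)\<close>
  apart. Convergence to \<open>x\<close> follows from \<open>2^k \<le> d\<close>.\<close>

lemma cylinder_slope_tendsto:
  assumes cyl: "\<And>k. cylinder k (M k)" and t: "\<And>k. 0 < t k" "\<And>k. t k < 1" "\<And>k. x = M k (t k)"
    and D: "(F has_real_derivative D) (at x within {0..1})"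
    and pq: "0 \<le> p" "p \<le> 1" "0 \<le> q" "q \<le> 1" "p \<noteq> q"
  shows "(\<lambda>k. \<bar>F (M k p) - F (M k q)\<bar> / \<bar>M k p - M k q\<bar>) \<longlonglongrightarrow> \<bar>D\<bar>"
proof -
  have main: "\<bar>M k s - x\<bar> \<le> (1/2)^k" "\<bar>M k s - x\<bar> \<le> 4 / \<bar>p - q\<bar> * \<bar>M k p - M k q\<bar>"
    "M k p \<noteq> M k q" "M k s \<in> {0..1}" if s: "0 \<le> s" "s \<le> 1" for k s
    using cyl[of k]
  proof (atomize (full), rule cylinderE)
    fix c d \<alpha> \<beta> assume M: "0 \<le> c" "c \<le> d" "2^k \<le> d" "\<beta> \<noteq> 0"
      "\<And>u. 0 \<le> u \<Longrightarrow> u \<le> 1 \<Longrightarrow> 0 \<le> M k u \<and> M k u \<le> 1"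
      "\<And>u v. 0 \<le> u \<Longrightarrow> u \<le> 1 \<Longrightarrow> 0 \<le> v \<Longrightarrow> v \<le> 1 \<Longrightarrow>
         \<bar>M k u - M k v\<bar> = \<bar>u - v\<bar> / ((c * u + d) * (c * v + d))"
    have d: "d \<ge> 1" using M(3) one_le_power[of "2::real" k] by linarith
    have den: "d \<le> c * u + d" "c * u + d \<le> 2 * d" if "0 \<le> u" "u \<le> 1" for u
    proof -
      have "0 \<le> c * u" "c * u \<le> c" using M(1) that by (auto intro: mult_left_le)
      then show "d \<le> c * u + d" "c * u + d \<le> 2 * d" using M(2) by auto
    qed
    have tk: "0 \<le> t k" "t k \<le> 1" using t by (simp_all add: less_imp_le)
    have "\<bar>M k s - x\<bar> = \<bar>s - t k\<bar> / ((c * s + d) * (c * t k + d))"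
      unfolding t(3)[of k] by (rule M(6)) (use s tk in auto)
    also have "\<dots> \<le> 1 / (d * d)"
      using den[OF s] den[OF tk] d s tk by (intro frac_le mult_mono) auto
    finally have 1: "\<bar>M k s - x\<bar> \<le> 1 / (d * d)" .
    have "2^k * 1 \<le> d * d" using M(3) d by (intro mult_mono) auto
    then have "1 / (d * d) \<le> 1 / 2^k" by (intro divide_left_mono) (use d in auto)
    then have A: "\<bar>M k s - x\<bar> \<le> (1/2)^k" using 1 by (simp add: power_divide)
    have "\<bar>p - q\<bar> / ((2 * d) * (2 * d)) \<le> \<bar>p - q\<bar> / ((c * p + d) * (c * q + d))"
      using den[of p] den[of q] pq d by (intro divide_left_mono mult_mono mult_pos_pos) auto
    then have 2: "\<bar>p - q\<bar> / ((2 * d) * (2 * d)) \<le> \<bar>M k p - M k q\<bar>" using M(6)[of p q] pq by simp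
    have "1 / (d * d) = 4 / \<bar>p - q\<bar> * (\<bar>p - q\<bar> / ((2 * d) * (2 * d)))" using pq d by simp
    also have "\<dots> \<le> 4 / \<bar>p - q\<bar> * \<bar>M k p - M k q\<bar>" using 2 by (intro mult_left_mono) auto
    finally have B: "\<bar>M k s - x\<bar> \<le> 4 / \<bar>p - q\<bar> * \<bar>M k p - M k q\<bar>" using 1 by linarith
    have "0 < \<bar>p - q\<bar> / ((2 * d) * (2 * d))" using pq d by simp
    then have "M k p \<noteq> M k q" using 2 by auto
    with A B M(5)[OF s] show "(\<bar>M k s - x\<bar> \<le> (1/2)^k \<and> \<bar>M k s - x\<bar> \<le> 4 / \<bar>p - q\<bar> * \<bar>M k p - M k q\<bar>) \<and>
        M k p \<noteq> M k q \<and> M k s \<in> {0..1}" by simp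
  qed
  have lim: "(\<lambda>k. M k s) \<longlonglongrightarrow> x" if "0 \<le> s" "s \<le> 1" for s
  proof -
    have "(\<lambda>k. M k s - x) \<longlonglongrightarrow> 0"
    proof (rule Lim_null_comparison)
      show "\<forall>\<^sub>F k in sequentially. norm (M k s - x) \<le> (1/2)^k"
        using main(1)[OF that] by (auto intro: always_eventually)
      show "(\<lambda>k. (1/2)^k :: real) \<longlonglongrightarrow> 0" by (intro LIMSEQ_power_zero) auto
    qed
    then show ?thesis by (simp add: LIM_zero_iff)
  qed
  have "(\<lambda>k. (F (M k p) - F (M k q)) / (M k p - M k q)) \<longlonglongrightarrow> D"
    using main pq lim by (intro chord_slope_tendsto[OF D, where C = "4 / \<bar>p - q\<bar>"]) auto
  then have "(\<lambda>k. \<bar>(F (M k p) - F (M k q)) / (M k p - M k q)\<bar>) \<longlonglongrightarrow> \<bar>D\<bar>" by (rule tendsto_rabs)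
  then show ?thesis by (simp only: abs_divide)
qed

text \<open>
  The cross ratio of \<open>0, 1/3, 1/2, 1\<close> is \<open>1/2\<close> and preserved by \<open>M\<close>; that of the values of \<open>F\<close>
  is \<open>\<tau>^2\<close> and preserved as \<open>F \<circ> M\<close> is affine in \<open>F\<close>.
\<close>

lemma cylinder_cross_ratio:
  assumes "cylinder k M"
  defines "Q \<equiv> \<lambda>p q. \<bar>F (M p) - F (M q)\<bar> / \<bar>M p - M q\<bar>"
  shows "Q 0 (1/3) * Q (1/2) 1 = 2 * \<tau>^2 * (Q 0 (1/2) * Q (1/3) 1)"
  using assms(1)
proof (rule cylinderE)
  fix c d \<alpha> \<beta> assume M: "0 \<le> c" "c \<le> d" "2^k \<le> d" "\<beta> \<noteq> 0"
    "\<And>t. 0 \<le> t \<Longrightarrow> t \<le> 1 \<Longrightarrow> 0 \<le> M t \<and> M t \<le> 1"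
    "\<And>t. 0 \<le> t \<Longrightarrow> t \<le> 1 \<Longrightarrow> F (M t) = \<alpha> + \<beta> * F t"
    "\<And>s t. 0 \<le> s \<Longrightarrow> s \<le> 1 \<Longrightarrow> 0 \<le> t \<Longrightarrow> t \<le> 1 \<Longrightarrow>
       \<bar>M s - M t\<bar> = \<bar>s - t\<bar> / ((c * s + d) * (c * t + d))"
  have d: "d > 0" using M(3) by (rule less_le_trans[rotated]) simp
  have Q: "Q p q = \<bar>\<beta>\<bar> * \<bar>F p - F q\<bar> * ((c * p + d) * (c * q + d)) / \<bar>p - q\<bar>"
    if "0 \<le> p" "p \<le> 1" "0 \<le> q" "q \<le> 1" for p q
  proof -
    have "F (M p) - F (M q) = \<beta> * (F p - F q)" using M(6) that by (simp add: right_diff_distrib)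
    then show ?thesis unfolding Q_def using M(7)[OF that] by (simp add: abs_mult)
  qed
  \<comment> \<open>In terms of \<open>g\<close>, the values of \<open>F\<close> at 0, 1/3, 1/2, 1
    are 0, \<open>\<tau> * g\<close>, \<open>g\<close>, \<open>g + \<tau> * g\<close>, whence the
    cross ratio \<open>\<tau>^2\<close>.\<close>
  define g where "g = F (1/2)"
  have g: "g > 0" using F_half_pos by (simp add: g_def)
  have F3: "F (1/3) = \<tau> * g" using F_reciprocal[of 1] by (simp add: g_def)
  have F1: "F 1 = g + \<tau> * g" using F_reflect[of "1/2"] F_1 by (simp add: g_def)
  show ?thesis
    using g \<tau>_root(1) by (simp add: Q F_0 F3 F1 flip: g_def) (simp add: abs_mult field_simps power2_eq_square)
qed

text \<open>Follows from monotonicity of \<open>F\<close>; it excludes the value minus infinity in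
  the final case split.\<close>

lemma ext_derivative_nonneg:
  assumes "x \<in> {0..1}" "has_ext_derivative F L x {0..1}"
  shows "L \<ge> 0"
proof (rule tendsto_lowerbound)
  show "((\<lambda>y. ereal ((F y - F x) / (y - x))) \<longlongrightarrow> L) (at x within {0..1})"
    using assms(2) by (simp add: has_ext_derivative_def)
  have "0 \<le> (F y - F x) / (y - x)" if "y \<in> {0..1}" for y
    using F_mono[of x y] F_mono[of y x] assms(1) that
    by (cases "x \<le> y") (auto intro: divide_nonneg_nonneg divide_nonpos_nonpos)
  then show "\<forall>\<^sub>F y in at x within {0..1}. 0 \<le> ereal ((F y - F x) / (y - x))"
    by (auto simp: eventually_at_filter intro!: always_eventually)
  show "at x within {0..1} \<noteq> bot"
    using assms(1) by (simp add: trivial_limit_within islimpt_Icc)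
qed

theorem theorem2:
  fixes x :: real and L :: ereal
  assumes "x \<in> {0..1}"
    and "has_ext_derivative F L x {0..1}"
  shows "L = 0 \<or> L = \<infinity>"
proof (cases "\<exists>k M. cylinder k M \<and> (x = M 0 \<or> x = M 1)")
  case True
  then show ?thesis using derivative_at_endpoint assms(2) by blast
next
  case False
  then have "\<forall>k. \<exists>M t. cylinder k M \<and> 0 < t \<and> t < 1 \<and> x = M t"
    using cylinder_dichotomy[of x] assms(1) by auto
  then obtain M t where M: "\<And>k. cylinder k (M k)" "\<And>k. 0 < t k" "\<And>k. t k < 1" "\<And>k. x = M k (t k)"
    by metis
  show ?thesis
  proof (cases L)
    case (real D)
    then have D: "(F has_real_derivative D) (at x within {0..1})"
      using assms(2) has_ext_derivative_finite_iff by blast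
    define Q where "Q k p q = \<bar>F (M k p) - F (M k q)\<bar> / \<bar>M k p - M k q\<bar>" for k p q
    have Q: "(\<lambda>k. Q k p q) \<longlonglongrightarrow> \<bar>D\<bar>" if "0 \<le> p" "p \<le> 1" "0 \<le> q" "q \<le> 1" "p \<noteq> q" for p q
      unfolding Q_def by (rule cylinder_slope_tendsto[OF M D that])
    \<comment> \<open>All four slopes tend to \<open>\<bar>D\<bar>\<close>, so this identity becomes
      \<open>D^2 = 2 * \<tau>^2 * D^2\<close> in the limit.\<close>
    have "Q k 0 (1/3) * Q k (1/2) 1 = 2 * \<tau>^2 * (Q k 0 (1/2) * Q k (1/3) 1)" for k
      using cylinder_cross_ratio[OF M(1)[of k]] by (simp add: Q_def)
    moreover have "(\<lambda>k. Q k 0 (1/3) * Q k (1/2) 1) \<longlonglongrightarrow> \<bar>D\<bar> * \<bar>D\<bar>" by (intro tendsto_mult Q) auto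
    ultimately have "(\<lambda>k. 2 * \<tau>^2 * (Q k 0 (1/2) * Q k (1/3) 1)) \<longlonglongrightarrow> \<bar>D\<bar> * \<bar>D\<bar>"
      by (simp only:)
    moreover have "(\<lambda>k. 2 * \<tau>^2 * (Q k 0 (1/2) * Q k (1/3) 1)) \<longlonglongrightarrow> 2 * \<tau>^2 * (\<bar>D\<bar> * \<bar>D\<bar>)"
      by (intro tendsto_mult tendsto_const Q) auto
    ultimately have "\<bar>D\<bar> * \<bar>D\<bar> = 2 * \<tau>^2 * (\<bar>D\<bar> * \<bar>D\<bar>)" by (rule LIMSEQ_unique)
    then have "D * D * (2 * \<tau>^2 - 1) = 0" by (simp add: algebra_simps)
    then have "D = 0" using \<tau>_square_neq_half by simp
    then show ?thesis using real by simp
  qed (use ext_derivative_nonneg[OF assms] in auto)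
qed

end
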